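(* Let $X$ be a compact metric space, $T\colon X\to X$ a homeomorphism, $\mu\in\mathcal{M}_T(X)$ a $T$-invariant Borel probability measure, and $\Xi\subseteq\mathbb{S}^1$. The following conditions are equivalent: (1) The measure $\mu$ is ergodic, has discrete spectrum, and $\operatorname{Spec}(X,T,\mu)\subseteq\Xi$. (2) There exists a Borel set $X'\subseteq X$ with $\mu(X')=1$ such that every $x\in X'$ is a Wiener--Wintner $\mu$-generic point and for every $f\in C(X)$ $$\int|f|^2\,d\mu=\sum_{\xi\in\Xi}|A[f,\bar\xi](x)|^2 .\qquad( * )$$ (3) There exist a $\mu$-generic point $x\in X$ and a countable dense set $\mathcal{D}\subseteq C(X)$ such that for every $f\in\mathcal{D}$ and every $\xi\in\Xi$ the limit $A[f,\bar\xi](x)$ exists, and equality $( * )$ holds for every $f\in\mathcal{D}$. (4) There exists a Wiener--Wintner $\mu$-generic point $x\in X$ such that $( * )$ holds for every $f\in C(X)$ and $\operatorname{Freq}(x)\subseteq\Xi$.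
   Context: $\mathcal{M}_T(X)$ denotes the set of $T$-invariant Borel probability measures on $X$; $C(X)$ denotes the continuous functions $X\to\mathbb{C}$ with the sup norm; $\mathbb{S}^1=\{z\in\mathbb{C}:|z|=1\}$. A point $x\in X$ is generic for $\mu$ ($\mu$-generic) if $\frac1n\sum_{j=0}^{n-1}f(T^j(x))\to\int f\,d\mu$ for every $f\in C(X)$. For $f\in C(X)$, $\xi\in\mathbb{S}^1$, $n\ge1$ let $A_n[f,\bar\xi](x)=\frac1n\sum_{j=0}^{n-1}\xi^{-j}f(T^j(x))$, and let $A[f,\bar\xi](x)=\lim_{n\to\infty}A_n[f,\bar\xi](x)$ whenever the limit exists. A point $x$ is Fourier--Bohr $\mu$-generic if it is generic for $\mu$ and $A[f,\bar\xi](x)$ exists for every $f\in C(X)$ and every $\xi\in\mathbb{S}^1$. The set of frequencies of $x$ is $\operatorname{Freq}(x)=\{\xi\in\mathbb{S}^1:\ \limsup_{n\to\infty}|A_n[f,\bar\xi](x)|>0\text{ for some }f\in C(X)\}$. Let $U_T f=f\circ T$ be the Koopman operator on $L^2(X,\mu)$; $\operatorname{Spec}(X,T,\mu)\subseteq\mathbb{S}^1$ is the set of eigenvalues of $U_T$; $\mathcal{K}\subseteq L^2(X,\mu)$ is the closed linear span of all eigenfunctions of $U_T$, and $P_{\mathcal{K}}$ is the orthogonal projection onto $\mathcal{K}$. The measure $\mu$ has discrete spectrum if $\mathcal{K}=L^2(X,\mu)$. A Fourier--Bohr $\mu$-generic point $x$ is Wiener--Wintner $\mu$-generic if $\|P_{\mathcal{K}}(f)\|_2^2=\sum_{\xi\in\operatorname{Freq}(x)}|A[f,\bar\xi](x)|^2$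 for every $f\in C(X)$. Sums of nonnegative terms over possibly uncountable index sets are suprema of finite partial sums. *)

theory Defs
  imports "HOL-Analysis.Analysis" "HOL-Probability.Probability"
begin

text \<open>
  The compact metric space is a type \<open>'a :: metric_space\<close> whose universe is compact, and
  \<open>C(X)\<close> is the library type \<open>'a \<Rightarrow>\<^sub>C complex\<close> of bounded continuous functions with the sup norm
  (on a compact space boundedness is automatic).
\<close>

definition invariant_prob_measures :: "('a::metric_space \<Rightarrow> 'a) \<Rightarrow> 'a measure set" where
  "invariant_prob_measures T =
     {M. prob_space M \<and> sets M = sets borel \<and> distr M borel T = M}"

definition ergodic_measure :: "('a::metric_space \<Rightarrow> 'a) \<Rightarrow> 'a measure \<Rightarrow> bool" where
  "ergodic_measure T M \<longleftrightarrow>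
     (\<forall>A\<in>sets M. T -` A = A \<longrightarrow> measure M A = 0 \<or> measure M A = 1)"


subsection \<open>The space L2 and the Koopman operator\<close>

text \<open>
  Elements of \<open>L\<^sup>2(X,\<mu>)\<close> are handled through representatives: equality in \<open>L\<^sup>2\<close> is equality
  almost everywhere, and all sets of representatives below are closed under it.
\<close>

definition L2 :: "'a measure \<Rightarrow> ('a \<Rightarrow> complex) set" where
  "L2 M = {f \<in> borel_measurable M. integrable M (\<lambda>x. (cmod (f x))\<^sup>2)}"

definition L2_inner :: "'a measure \<Rightarrow> ('a \<Rightarrow> complex) \<Rightarrow> ('a \<Rightarrow> complex) \<Rightarrow> complex" where
  "L2_inner M f g = (\<integral>x. f x * cnj (g x) \<partial>M)"

definition L2_norm :: "'a measure \<Rightarrow> ('a \<Rightarrow> complex) \<Rightarrow> real" where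
  "L2_norm M f = sqrt (\<integral>x. (cmod (f x))\<^sup>2 \<partial>M)"

definition koopman :: "('a \<Rightarrow> 'a) \<Rightarrow> ('a \<Rightarrow> complex) \<Rightarrow> 'a \<Rightarrow> complex" where
  "koopman T f = f \<circ> T"

definition koopman_eigenfunction ::
    "('a \<Rightarrow> 'a) \<Rightarrow> 'a measure \<Rightarrow> complex \<Rightarrow> ('a \<Rightarrow> complex) \<Rightarrow> bool" where
  "koopman_eigenfunction T M \<xi> f \<longleftrightarrow>
     f \<in> L2 M \<and> \<not> (AE x in M. f x = 0) \<and> (AE x in M. koopman T f x = \<xi> * f x)"

text \<open>
  No restriction to the unit circle is needed in the next definition: the Koopman operator of an
  invariant measure is an isometry, so all its eigenvalues have modulus 1.
\<close>

definition Spec :: "('a \<Rightarrow> 'a) \<Rightarrow> 'a measure \<Rightarrow> complex set" where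
  "Spec T M = {\<xi>. \<exists>f. koopman_eigenfunction T M \<xi> f}"

definition L2_closed_span :: "'a measure \<Rightarrow> ('a \<Rightarrow> complex) set \<Rightarrow> ('a \<Rightarrow> complex) set" where
  "L2_closed_span M E =
     {f \<in> L2 M. \<forall>\<epsilon>>0. \<exists>F c. finite F \<and> F \<subseteq> E \<and>
        L2_norm M (\<lambda>x. f x - (\<Sum>e\<in>F. c e * e x)) < \<epsilon>}"

definition kronecker_space :: "('a \<Rightarrow> 'a) \<Rightarrow> 'a measure \<Rightarrow> ('a \<Rightarrow> complex) set" where
  "kronecker_space T M = L2_closed_span M {f. \<exists>\<xi>. koopman_eigenfunction T M \<xi> f}"

text \<open>The orthogonal projection is unique up to equality almost everywhere; a representative
  is chosen.\<close>

definition L2_proj ::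
    "'a measure \<Rightarrow> ('a \<Rightarrow> complex) set \<Rightarrow> ('a \<Rightarrow> complex) \<Rightarrow> 'a \<Rightarrow> complex" where
  "L2_proj M K f = (SOME g. g \<in> K \<and> (\<forall>h\<in>K. L2_inner M (\<lambda>x. f x - g x) h = 0))"

definition discrete_spectrum :: "('a \<Rightarrow> 'a) \<Rightarrow> 'a measure \<Rightarrow> bool" where
  "discrete_spectrum T M \<longleftrightarrow> kronecker_space T M = L2 M"


subsection \<open>Fourier--Bohr averages and generic points\<close>

definition generic_point :: "('a::metric_space \<Rightarrow> 'a) \<Rightarrow> 'a measure \<Rightarrow> 'a \<Rightarrow> bool" where
  "generic_point T M x \<longleftrightarrow>
     (\<forall>f :: 'a \<Rightarrow>\<^sub>C complex.
        (\<lambda>n. (\<Sum>j<n. f ((T ^^ j) x)) / of_nat n) \<longlonglongrightarrow> (\<integral>y. f y \<partial>M))"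

text \<open>\<open>FB_avg T f \<xi> n x\<close> is \<open>A\<^sub>n[f, \<xi>\<^sup>-\<^sup>1](x)\<close>: the argument is \<open>\<xi>\<close>, the weights are powers of its
  conjugate. The value at \<open>n = 0\<close> is the irrelevant \<open>0 / 0 = 0\<close>.\<close>

definition FB_avg ::
    "('a::metric_space \<Rightarrow> 'a) \<Rightarrow> ('a \<Rightarrow>\<^sub>C complex) \<Rightarrow> complex \<Rightarrow> nat \<Rightarrow> 'a \<Rightarrow> complex" where
  "FB_avg T f \<xi> n x = (\<Sum>j<n. \<xi> powi (- int j) * f ((T ^^ j) x)) / of_nat n"

definition FB_exists ::
    "('a::metric_space \<Rightarrow> 'a) \<Rightarrow> ('a \<Rightarrow>\<^sub>C complex) \<Rightarrow> complex \<Rightarrow> 'a \<Rightarrow> bool" where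
  "FB_exists T f \<xi> x \<longleftrightarrow> convergent (\<lambda>n. FB_avg T f \<xi> n x)"

definition FB_lim ::
    "('a::metric_space \<Rightarrow> 'a) \<Rightarrow> ('a \<Rightarrow>\<^sub>C complex) \<Rightarrow> complex \<Rightarrow> 'a \<Rightarrow> complex" where
  "FB_lim T f \<xi> x = lim (\<lambda>n. FB_avg T f \<xi> n x)"

definition FB_generic_point :: "('a::metric_space \<Rightarrow> 'a) \<Rightarrow> 'a measure \<Rightarrow> 'a \<Rightarrow> bool" where
  "FB_generic_point T M x \<longleftrightarrow>
     generic_point T M x \<and> (\<forall>f. \<forall>\<xi>\<in>sphere 0 1. FB_exists T f \<xi> x)"

definition Freq :: "('a::metric_space \<Rightarrow> 'a) \<Rightarrow> 'a \<Rightarrow> complex set" where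
  "Freq T x =
     {\<xi> \<in> sphere 0 1. \<exists>f. limsup (\<lambda>n. ereal (cmod (FB_avg T f \<xi> n x))) > 0}"

text \<open>Summing in \<open>ennreal\<close> makes the infinite sum over an arbitrary index set the supremum of
  the finite partial sums, with value \<open>\<infinity>\<close> (and not the default 0) in the divergent case.\<close>

definition FB_square_sum ::
    "('a::metric_space \<Rightarrow> 'a) \<Rightarrow> ('a \<Rightarrow>\<^sub>C complex) \<Rightarrow> complex set \<Rightarrow> 'a \<Rightarrow> ennreal" where
  "FB_square_sum T f S x = (\<Sum>\<^sub>\<infinity>\<xi>\<in>S. ennreal ((cmod (FB_lim T f \<xi> x))\<^sup>2))"

lemma FB_square_sum_eq_SUP:
  "FB_square_sum T f S x =
     (SUP F\<in>{F. finite F \<and> F \<subseteq> S}. \<Sum>\<xi>\<in>F. ennreal ((cmod (FB_lim T f \<xi> x))\<^sup>2))"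
  unfolding FB_square_sum_def by (rule nonneg_infsum_complete) simp

definition WW_generic_point :: "('a::metric_space \<Rightarrow> 'a) \<Rightarrow> 'a measure \<Rightarrow> 'a \<Rightarrow> bool" where
  "WW_generic_point T M x \<longleftrightarrow>
     FB_generic_point T M x \<and>
     (\<forall>f. ennreal ((L2_norm M (L2_proj M (kronecker_space T M) (apply_bcontfun f)))\<^sup>2) =
            FB_square_sum T f (Freq T x) x)"

end

theory Submission
  imports Defs
begin

text \<open>
  All four conditions say the same thing about the orbits of points: there is a \<open>\<mu>\<close>-generic point
  \<open>x\<close> such that for every continuous \<open>f\<close> the sequence \<open>f (T\<^sup>k x)\<close> can be approximated, in quadratic
  mean along the orbit, by trigonometric polynomials with frequencies in \<open>\<Xi>\<close>. Such an \<open>x\<close> is called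
  an almost periodic point below, and each condition is proved equivalent to its existence.

  For a single sequence, orthogonality of the characters \<open>k \<mapsto> \<xi>\<^sup>k\<close> under averaging gives a Bessel
  identity (\<open>rms_diff_trig_poly\<close>). Hence a sequence is almost periodic with frequencies in \<open>\<Xi>\<close>
  exactly when its Fourier--Bohr coefficients over \<open>\<Xi>\<close> satisfy Parseval's equality
  (\<open>parseval_mean\<close>). Along a generic orbit the quadratic mean of \<open>f\<close> is its \<open>L\<^sup>2\<close> norm, so this is the
  equality required in \<open>C2\<close>, \<open>C3\<close> and \<open>C4\<close>. Almost periodicity survives uniform limits, so the
  equality on a dense set of functions is enough, which is what \<open>C3\<close> provides. Existence of all
  the averages and the inclusion of the frequencies in \<open>\<Xi>\<close> follow directly; the Wiener--Wintner equality
  follows once the spectrum is known to be discrete.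

  If \<open>\<mu>\<close> is ergodic with discrete spectrum, write \<open>f\<close> as a finite combination of
  eigenfunctions plus an \<open>L\<^sup>2\<close>-small remainder \<open>g\<close>. On almost every orbit the eigenfunctions trace out a
  trigonometric polynomial, and Birkhoff's theorem applied to \<open>|g|\<^sup>2\<close> bounds the remainder; hence almost
  every point is almost periodic (\<open>AE_almost_periodic_point\<close>). Birkhoff's theorem is derived here for
  ergodic measures from a maximal function, and the passage to a single null set uses
  the separability of \<open>C(X)\<close>.

  Conversely, let \<open>x\<close> be an almost periodic point. By genericity, \<open>L\<^sup>2\<close> norms of continuous functions
  can be read off along the orbit of \<open>x\<close>. There the averages \<open>y \<mapsto> A\<^sub>n[f, \<xi>\<^sup>-\<^sup>1](y)\<close> approach
  \<open>c \<xi>\<^sup>k\<close> with \<open>c\<close> the Fourier--Bohr coefficient at \<open>x\<close> (\<open>almost_periodic_shifted_avg\<close>), so they are Cauchy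
  in \<open>L\<^sup>2\<close>; the limit, the eigencomponent of \<open>f\<close>, is an eigenfunction or zero. Finite sums of
  eigencomponents approximate \<open>f\<close>, and continuous functions are dense in \<open>L\<^sup>2\<close>, so the spectrum is
  discrete. A function orthogonal to all eigencomponents vanishes: applied to an eigenfunction with eigenvalue
  outside \<open>\<Xi>\<close> this bounds the spectrum, and applied to the centred indicator of an
  invariant set it gives ergodicity, because the eigencomponents for \<open>\<xi> = 1\<close> are constants.
\<close>


section \<open>Quadratic means of sequences and trigonometric polynomials\<close>

definition rms :: "nat \<Rightarrow> (nat \<Rightarrow> complex) \<Rightarrow> real" where
  "rms n u = sqrt ((\<Sum>k<n. (cmod (u k))\<^sup>2) / real n)"

text \<open>
  The limit superior of the quadratic means is at most \<open>c\<close>, i.e. the Besicovitch seminorm of \<open>u\<close> is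
  bounded by \<open>c\<close>. Only upper bounds on the seminorm ever matter, and as a relation they can be added and
  scaled without asking whether the limit superior is finite.
\<close>

definition asymp_rms_le :: "(nat \<Rightarrow> complex) \<Rightarrow> real \<Rightarrow> bool" where
  "asymp_rms_le u c \<longleftrightarrow> (\<forall>\<epsilon>>0. \<forall>\<^sub>F n in sequentially. rms n u \<le> c + \<epsilon>)"

lemma rms_eq_L2_set: "rms n u = L2_set (\<lambda>k. cmod (u k)) {..<n} / sqrt (real n)"
  by (simp add: rms_def L2_set_def real_sqrt_divide)

lemma rms_nonneg [simp]: "0 \<le> rms n u"
  by (simp add: rms_def sum_nonneg)

lemma rms_power2: "(rms n u)\<^sup>2 = (\<Sum>k<n. (cmod (u k))\<^sup>2) / real n"
  by (simp add: rms_def sum_nonneg)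

lemma rms_triangle: "rms n (\<lambda>k. u k + v k) \<le> rms n u + rms n v"
proof -
  have "L2_set (\<lambda>k. cmod (u k + v k)) {..<n} \<le> L2_set (\<lambda>k. cmod (u k) + cmod (v k)) {..<n}"
    by (rule L2_set_mono) (auto intro: norm_triangle_ineq)
  also have "\<dots> \<le> L2_set (\<lambda>k. cmod (u k)) {..<n} + L2_set (\<lambda>k. cmod (v k)) {..<n}"
    by (rule L2_set_triangle_ineq)
  finally show ?thesis
    unfolding rms_eq_L2_set add_divide_distrib[symmetric] by (rule divide_right_mono) simp
qed

lemma rms_scale: "rms n (\<lambda>k. a * u k) = cmod a * rms n u"
  by (simp add: rms_eq_L2_set norm_mult L2_set_right_distrib)

lemma rms_le_bound:
  assumes "\<And>k. cmod (u k) \<le> c" "0 \<le> c"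
  shows "rms n u \<le> c"
proof -
  have "(\<Sum>k<n. (cmod (u k))\<^sup>2) \<le> (\<Sum>k<n. c\<^sup>2)"
    using assms by (intro sum_mono power_mono) auto
  hence "(\<Sum>k<n. (cmod (u k))\<^sup>2) \<le> c\<^sup>2 * real n" by (simp add: mult.commute)
  hence "(\<Sum>k<n. (cmod (u k))\<^sup>2) / real n \<le> c\<^sup>2"
    by (cases "n = 0") (auto simp: divide_simps)
  thus ?thesis unfolding rms_def using assms(2) real_le_lsqrt by blast
qed

lemma weighted_mean_le_rms:
  assumes "\<And>k. cmod (w k) \<le> 1"
  shows "cmod ((\<Sum>k<n. w k * u k) / of_nat n) \<le> rms n u"
proof (cases "n = 0")
  case False
  have "cmod (\<Sum>k<n. w k * u k) \<le> (\<Sum>k<n. \<bar>1\<bar> * \<bar>cmod (u k)\<bar>)"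
    using assms by (intro sum_norm_le) (auto simp: norm_mult intro: mult_left_le_one_le)
  also have "\<dots> \<le> L2_set (\<lambda>k. 1) {..<n} * L2_set (\<lambda>k. cmod (u k)) {..<n}"
    by (rule L2_set_mult_ineq)
  also have "L2_set (\<lambda>k::nat. 1) {..<n} = sqrt (real n)" by (simp add: L2_set_constant)
  finally have "cmod (\<Sum>k<n. w k * u k) / real n \<le> sqrt (real n) * L2_set (\<lambda>k. cmod (u k)) {..<n} / real n"
    by (rule divide_right_mono) simp
  also have "\<dots> = rms n u"
    using False by (simp add: rms_eq_L2_set field_simps flip: real_sqrt_mult)
  finally show ?thesis by (simp add: norm_divide)
qed (simp add: rms_def)

lemma asymp_rms_leD:
  assumes "asymp_rms_le u c" "c < d"
  shows "\<forall>\<^sub>F n in sequentially. rms n u < d"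
proof -
  have "\<forall>\<^sub>F n in sequentially. rms n u \<le> c + (d - c) / 2"
    using assms unfolding asymp_rms_le_def by simp
  thus ?thesis by eventually_elim (use assms(2) in \<open>simp add: field_simps\<close>)
qed

lemma asymp_rms_le_add:
  assumes "asymp_rms_le u a" "asymp_rms_le v b"
  shows "asymp_rms_le (\<lambda>k. u k + v k) (a + b)"
  unfolding asymp_rms_le_def
proof safe
  fix \<epsilon> :: real assume "0 < \<epsilon>"
  hence "\<forall>\<^sub>F n in sequentially. rms n u < a + \<epsilon>/2" "\<forall>\<^sub>F n in sequentially. rms n v < b + \<epsilon>/2"
    using assms asymp_rms_leD by auto
  thus "\<forall>\<^sub>F n in sequentially. rms n (\<lambda>k. u k + v k) \<le> a + b + \<epsilon>"
  proof eventually_elim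
    case (elim n)
    thus ?case using rms_triangle[of n u v] by linarith
  qed
qed

lemma asymp_rms_le_scale:
  assumes "asymp_rms_le u a"
  shows "asymp_rms_le (\<lambda>k. c * u k) (cmod c * a)"
  unfolding asymp_rms_le_def
proof safe
  fix \<epsilon> :: real assume e: "0 < \<epsilon>"
  have pos: "0 < cmod c + 1" by (simp add: add_nonneg_pos)
  from e have "0 < \<epsilon> / (cmod c + 1)" using pos by simp
  hence "\<forall>\<^sub>F n in sequentially. rms n u \<le> a + \<epsilon> / (cmod c + 1)"
    using assms unfolding asymp_rms_le_def by blast
  thus "\<forall>\<^sub>F n in sequentially. rms n (\<lambda>k. c * u k) \<le> cmod c * a + \<epsilon>"
  proof eventually_elim
    case (elim n)
    have "cmod c * rms n u \<le> cmod c * (a + \<epsilon> / (cmod c + 1))"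
      using elim by (intro mult_left_mono) auto
    also have "\<dots> = cmod c * a + cmod c * (\<epsilon> / (cmod c + 1))" by (rule distrib_left)
    also have "cmod c * (\<epsilon> / (cmod c + 1)) = \<epsilon> * (cmod c / (cmod c + 1))" by simp
    also have "\<dots> \<le> \<epsilon> * 1" using e pos by (intro mult_left_mono) (auto simp: pos_divide_le_eq)
    finally show ?case by (simp add: rms_scale)
  qed
qed

lemma asymp_rms_le_diff:
  assumes "asymp_rms_le u a" "asymp_rms_le v b"
  shows "asymp_rms_le (\<lambda>k. u k - v k) (a + b)"
  using asymp_rms_le_add[OF assms(1) asymp_rms_le_scale[OF assms(2), of "-1"]] by simp

lemma asymp_rms_le_mono: "asymp_rms_le u a \<Longrightarrow> a \<le> b \<Longrightarrow> asymp_rms_le u b"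
  unfolding asymp_rms_le_def
  by (meson add_right_mono eventually_mono order_trans)

lemma asymp_rms_le_bound:
  assumes "\<And>k. cmod (u k) \<le> c" "0 \<le> c"
  shows "asymp_rms_le u c"
  unfolding asymp_rms_le_def
  using rms_le_bound[OF assms] by (simp add: add_increasing2 always_eventually)

lemma asymp_rms_le_sum:
  assumes "finite A" "\<And>i. i \<in> A \<Longrightarrow> asymp_rms_le (u i) (c i)"
  shows "asymp_rms_le (\<lambda>k. \<Sum>i\<in>A. u i k) (\<Sum>i\<in>A. c i)"
  using assms
proof (induction A)
  case empty
  show ?case by (simp add: asymp_rms_le_bound)
qed (simp add: asymp_rms_le_add)

lemma rms_shift: "rms n (\<lambda>k. u (Suc k)) \<le> sqrt (real (Suc n) / real n) * rms (Suc n) u"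
proof (cases "n = 0")
  case False
  have "(\<Sum>k<n. (cmod (u (Suc k)))\<^sup>2) \<le> (\<Sum>k<Suc n. (cmod (u k))\<^sup>2)"
    unfolding sum.lessThan_Suc_shift by simp
  hence "(\<Sum>k<n. (cmod (u (Suc k)))\<^sup>2) / real n \<le> (\<Sum>k<Suc n. (cmod (u k))\<^sup>2) / real n"
    by (rule divide_right_mono) simp
  also have "\<dots> = real (Suc n) / real n * ((\<Sum>k<Suc n. (cmod (u k))\<^sup>2) / real (Suc n))"
    using False by (simp del: sum.lessThan_Suc of_nat_Suc)
  finally show ?thesis
    unfolding rms_def real_sqrt_mult[symmetric] by (rule real_sqrt_le_mono)
qed (simp add: rms_def)

lemma asymp_rms_le_shift1:
  assumes "asymp_rms_le u c"
  shows "asymp_rms_le (\<lambda>k. u (Suc k)) c"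
  unfolding asymp_rms_le_def
proof safe
  fix \<epsilon> :: real assume e: "0 < \<epsilon>"
  have c: "0 \<le> c"
  proof (rule ccontr)
    assume "\<not> 0 \<le> c"
    hence "\<forall>\<^sub>F n in sequentially. rms n u < 0" using assms asymp_rms_leD by auto
    then obtain n where "rms n u < 0" using eventually_happens by force
    thus False by (simp add: leD)
  qed
  have ev: "\<forall>\<^sub>F n in sequentially. rms (Suc n) u < c + \<epsilon>/2"
    using asymp_rms_leD[OF assms, of "c + \<epsilon>/2"] e eventually_sequentially_Suc[of "\<lambda>n. rms n u < c + \<epsilon>/2"] by simp
  have "(\<lambda>n. 1 + 1 / real n) \<longlonglongrightarrow> 1 + 0"
    by (intro tendsto_intros lim_1_over_n)
  moreover have "\<forall>\<^sub>F n in sequentially. 1 + 1 / real n = real (Suc n) / real n"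
    using eventually_gt_at_top[of 0] by eventually_elim (simp add: field_simps)
  ultimately have "(\<lambda>n. real (Suc n) / real n) \<longlonglongrightarrow> 1"
    by (simp add: tendsto_cong)
  hence "(\<lambda>n. sqrt (real (Suc n) / real n) * (c + \<epsilon>/2)) \<longlonglongrightarrow> sqrt 1 * (c + \<epsilon>/2)"
    by (intro tendsto_intros)
  hence "\<forall>\<^sub>F n in sequentially. sqrt (real (Suc n) / real n) * (c + \<epsilon>/2) < c + \<epsilon>"
    by (rule order_tendstoD) (use e in simp)
  with ev show "\<forall>\<^sub>F n in sequentially. rms n (\<lambda>k. u (Suc k)) \<le> c + \<epsilon>"
  proof eventually_elim
    case (elim n)
    have "sqrt (real (Suc n) / real n) * rms (Suc n) u \<le> sqrt (real (Suc n) / real n) * (c + \<epsilon>/2)"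
      using elim by (intro mult_left_mono) auto
    thus ?case using elim rms_shift[of n u] by linarith
  qed
qed

text \<open>
  The seminorm ignores any finite initial segment. This invariance is what transfers an approximation
  of an orbit to all forward translates of that orbit.
\<close>

lemma asymp_rms_le_shift:
  assumes "asymp_rms_le u c"
  shows "asymp_rms_le (\<lambda>k. u (k + j)) c"
  using assms by (induction j) (auto dest: asymp_rms_le_shift1)

lemma asymp_rms_le_limit:
  assumes "asymp_rms_le u c" "(\<lambda>n. rms n u) \<longlonglongrightarrow> L"
  shows "L \<le> c"
proof (rule field_le_epsilon)
  fix e :: real assume "0 < e"
  hence "\<forall>\<^sub>F n in sequentially. rms n u \<le> c + e"
    using assms(1) unfolding asymp_rms_le_def by blast
  thus "L \<le> c + e" using tendsto_upperbound[OF assms(2)] by simp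
qed

lemma limit_asymp_rms_le:
  assumes "(\<lambda>n. rms n u) \<longlonglongrightarrow> L" "L \<le> c"
  shows "asymp_rms_le u c"
  unfolding asymp_rms_le_def
proof safe
  fix e :: real assume "0 < e"
  hence "\<forall>\<^sub>F n in sequentially. rms n u < c + e"
    using assms by (intro order_tendstoD(2)[OF assms(1)]) simp
  thus "\<forall>\<^sub>F n in sequentially. rms n u \<le> c + e" by eventually_elim simp
qed

subsection \<open>Fourier averages of sequences\<close>

definition bohr_avg :: "complex \<Rightarrow> nat \<Rightarrow> (nat \<Rightarrow> complex) \<Rightarrow> complex" where
  "bohr_avg \<xi> n u = (\<Sum>j<n. \<xi> powi (- int j) * u j) / of_nat n"

lemma unit_powi_minus:
  assumes "cmod \<xi> = 1"
  shows "\<xi> powi (- int j) = cnj \<xi> ^ j"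
proof -
  have "\<xi> * cnj \<xi> = 1" using assms complex_norm_square[of \<xi>] by simp
  hence "inverse \<xi> = cnj \<xi>" by (rule inverse_unique)
  thus ?thesis by (simp add: power_int_minus flip: power_inverse)
qed

lemma unit_powi_minus_mult: "cmod \<xi> = 1 \<Longrightarrow> \<xi> powi (- int j) * \<xi> ^ j = 1"
  by (cases "\<xi> = 0") (simp_all add: power_int_minus)

lemma cmod_unit_powi: "cmod \<xi> = 1 \<Longrightarrow> cmod (\<xi> powi m) = 1"
  by (simp add: norm_power_int)

lemma bohr_avg_add: "bohr_avg \<xi> n (\<lambda>k. u k + v k) = bohr_avg \<xi> n u + bohr_avg \<xi> n v"
  by (simp add: bohr_avg_def distrib_left sum.distrib add_divide_distrib)

lemma bohr_avg_scale: "bohr_avg \<xi> n (\<lambda>k. a * u k) = a * bohr_avg \<xi> n u"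
  by (simp add: bohr_avg_def sum_distrib_left mult_ac)

lemma bohr_avg_diff: "bohr_avg \<xi> n (\<lambda>k. u k - v k) = bohr_avg \<xi> n u - bohr_avg \<xi> n v"
  using bohr_avg_add[of \<xi> n u "\<lambda>k. -1 * v k"] bohr_avg_scale[of \<xi> n "-1" v] by simp

lemma bohr_avg_zero [simp]: "bohr_avg \<xi> n (\<lambda>k. 0) = 0"
  by (simp add: bohr_avg_def)

lemma bohr_avg_sum:
  "bohr_avg \<xi> n (\<lambda>k. \<Sum>i\<in>A. u i k) = (\<Sum>i\<in>A. bohr_avg \<xi> n (u i))"
  by (induction A rule: infinite_finite_induct) (simp_all add: bohr_avg_add)

lemma bohr_avg_le_rms: "cmod \<xi> = 1 \<Longrightarrow> cmod (bohr_avg \<xi> n u) \<le> rms n u"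
  unfolding bohr_avg_def by (rule weighted_mean_le_rms) (simp add: cmod_unit_powi)

lemma bohr_avg_character_eq:
  assumes "cmod \<xi> = 1" "0 < n"
  shows "bohr_avg \<xi> n (\<lambda>k. \<xi> ^ k) = 1"
  using assms by (simp add: bohr_avg_def unit_powi_minus_mult)

text \<open>
  The average is a geometric sum with ratio \<open>cnj \<xi> * \<eta> \<noteq> 1\<close>, which stays bounded, divided by \<open>n\<close>.
\<close>

lemma bohr_avg_character_neq:
  assumes "cmod \<xi> = 1" "cmod \<eta> = 1" "\<eta> \<noteq> \<xi>"
  shows "(\<lambda>n. bohr_avg \<xi> n (\<lambda>k. \<eta> ^ k)) \<longlonglongrightarrow> 0"
proof -
  define z where "z = cnj \<xi> * \<eta>"
  have "\<xi> * cnj \<xi> = 1" using assms complex_norm_square[of \<xi>] by simp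
  hence "z * \<xi> = \<eta>" by (simp add: z_def mult_ac)
  hence z1: "z \<noteq> 1" using assms(3) by auto
  have z2: "cmod z = 1" by (simp add: z_def norm_mult assms)
  have *: "bohr_avg \<xi> n (\<lambda>k. \<eta> ^ k) = (z ^ n - 1) / (z - 1) / of_nat n" for n
    using z1 by (simp add: bohr_avg_def unit_powi_minus[OF assms(1)] z_def geometric_sum flip: power_mult_distrib)
  have "(\<lambda>n. (2 / cmod (z - 1)) * (1 / real n)) \<longlonglongrightarrow> (2 / cmod (z - 1)) * 0"
    by (intro tendsto_intros lim_1_over_n)
  hence lim: "(\<lambda>n. (2 / cmod (z - 1)) * (1 / real n)) \<longlonglongrightarrow> 0" by simp
  show ?thesis
  proof (rule Lim_null_comparison[OF _ lim], rule always_eventually, rule allI)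
    fix n
    have "cmod (z ^ n - 1) \<le> cmod (z ^ n) + cmod 1" by (rule norm_triangle_ineq4)
    also have "\<dots> = 2" using z2 by (simp add: norm_power)
    finally have "cmod (z ^ n - 1) / (cmod (z - 1) * real n) \<le> 2 / (cmod (z - 1) * real n)"
      by (rule divide_right_mono) simp
    thus "cmod (bohr_avg \<xi> n (\<lambda>k. \<eta> ^ k)) \<le> (2 / cmod (z - 1)) * (1 / real n)"
      by (simp add: * norm_divide norm_mult)
  qed
qed

lemma bohr_avg_character:
  assumes "cmod \<xi> = 1" "cmod \<eta> = 1"
  shows "(\<lambda>n. bohr_avg \<xi> n (\<lambda>k. \<eta> ^ k)) \<longlonglongrightarrow> (if \<eta> = \<xi> then 1 else 0)"
proof (cases "\<eta> = \<xi>")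
  case True
  have "\<forall>\<^sub>F n in sequentially. bohr_avg \<xi> n (\<lambda>k. \<eta> ^ k) = 1"
    using eventually_gt_at_top[of 0] by eventually_elim (simp add: True assms(1) bohr_avg_character_eq)
  thus ?thesis using True by (simp add: tendsto_eventually)
qed (simp add: bohr_avg_character_neq assms)

definition trig_poly :: "complex set \<Rightarrow> (complex \<Rightarrow> complex) \<Rightarrow> nat \<Rightarrow> complex" where
  "trig_poly F b k = (\<Sum>\<xi>\<in>F. b \<xi> * \<xi> ^ k)"

lemma bohr_avg_trig_poly:
  assumes "finite F" "F \<subseteq> sphere 0 1" "cmod \<xi> = 1"
  shows "(\<lambda>n. bohr_avg \<xi> n (trig_poly F b)) \<longlonglongrightarrow> (if \<xi> \<in> F then b \<xi> else 0)"
proof -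
  have "(\<lambda>n. \<Sum>\<eta>\<in>F. b \<eta> * bohr_avg \<xi> n (\<lambda>k. \<eta> ^ k)) \<longlonglongrightarrow> (\<Sum>\<eta>\<in>F. b \<eta> * (if \<eta> = \<xi> then 1 else 0))"
    using assms by (intro tendsto_intros bohr_avg_character) auto
  also have "(\<Sum>\<eta>\<in>F. b \<eta> * (if \<eta> = \<xi> then 1 else 0)) = (if \<xi> \<in> F then b \<xi> else 0)"
    using assms(1) by (simp add: if_distrib cong: if_cong)
  finally show ?thesis
    by (simp add: trig_poly_def[abs_def] bohr_avg_sum bohr_avg_scale)
qed

lemma cmod_diff_power2: "(cmod (z - w))\<^sup>2 = (cmod z)\<^sup>2 - 2 * Re (z * cnj w) + (cmod w)\<^sup>2"
  unfolding cmod_power2 by (simp add: power2_eq_square algebra_simps)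

text \<open>
  Expanding the square leaves only the mixed term, whose average is the Fourier average of \<open>u\<close> at \<open>\<xi>\<close>;
  completing the square in \<open>b\<close> gives the limit.
\<close>

lemma rms_diff_character:
  assumes x: "cmod \<xi> = 1"
    and q: "(\<lambda>n. (rms n u)\<^sup>2) \<longlonglongrightarrow> q"
    and c: "(\<lambda>n. bohr_avg \<xi> n u) \<longlonglongrightarrow> c"
  shows "(\<lambda>n. (rms n (\<lambda>k. u k - b * \<xi> ^ k))\<^sup>2) \<longlonglongrightarrow> q - (cmod c)\<^sup>2 + (cmod (b - c))\<^sup>2"
proof -
  have pw: "(cmod (u k - b * \<xi> ^ k))\<^sup>2 =
      (cmod (u k))\<^sup>2 - 2 * Re (cnj b * (\<xi> powi (- int k) * u k)) + (cmod b)\<^sup>2" for k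
  proof -
    have "(cmod (u k - b * \<xi> ^ k))\<^sup>2 = (cmod (u k))\<^sup>2 - 2 * Re (u k * cnj (b * \<xi> ^ k)) + (cmod (b * \<xi> ^ k))\<^sup>2"
      by (rule cmod_diff_power2)
    thus ?thesis using x by (simp add: norm_mult norm_power unit_powi_minus mult_ac)
  qed
  have *: "(rms n (\<lambda>k. u k - b * \<xi> ^ k))\<^sup>2 =
      (rms n u)\<^sup>2 - 2 * Re (cnj b * bohr_avg \<xi> n u) + (cmod b)\<^sup>2" if "0 < n" for n
  proof -
    have "Re (cnj b * bohr_avg \<xi> n u) = (\<Sum>k<n. Re (cnj b * (\<xi> powi (- int k) * u k))) / real n"
      unfolding bohr_avg_def by (simp only: times_divide_eq_right sum_distrib_left Re_divide_of_nat Re_sum)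
    thus ?thesis unfolding rms_power2 pw
      using that by (simp add: sum.distrib sum_subtractf add_divide_distrib diff_divide_distrib flip: sum_distrib_left)
  qed
  have "(\<lambda>n. (rms n u)\<^sup>2 - 2 * Re (cnj b * bohr_avg \<xi> n u) + (cmod b)\<^sup>2)
      \<longlonglongrightarrow> q - 2 * Re (cnj b * c) + (cmod b)\<^sup>2"
    by (intro tendsto_intros q c)
  also have "q - 2 * Re (cnj b * c) + (cmod b)\<^sup>2 = q - (cmod c)\<^sup>2 + (cmod (b - c))\<^sup>2"
  proof -
    have "Re (b * cnj c) = Re (cnj b * c)" by simp
    thus ?thesis using cmod_diff_power2[of b c] by linarith
  qed
  finally have lim: "(\<lambda>n. (rms n u)\<^sup>2 - 2 * Re (cnj b * bohr_avg \<xi> n u) + (cmod b)\<^sup>2)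
      \<longlonglongrightarrow> q - (cmod c)\<^sup>2 + (cmod (b - c))\<^sup>2" .
  show ?thesis
  proof (rule Lim_transform_eventually[OF lim])
    show "\<forall>\<^sub>F n in sequentially. (rms n u)\<^sup>2 - 2 * Re (cnj b * bohr_avg \<xi> n u) + (cmod b)\<^sup>2
        = (rms n (\<lambda>k. u k - b * \<xi> ^ k))\<^sup>2"
      using eventually_gt_at_top[of 0] by eventually_elim (rule *[symmetric])
  qed
qed

text \<open>
  The Bessel identity. Subtracting one character changes the limiting quadratic mean by the
  previous lemma and leaves the coefficients at all other frequencies unchanged, so the
  frequencies can be removed one at a time.
\<close>

lemma rms_diff_trig_poly:
  assumes "finite F" "F \<subseteq> sphere 0 1"
    and q: "(\<lambda>n. (rms n u)\<^sup>2) \<longlonglongrightarrow> q"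
    and c: "\<And>\<xi>. \<xi> \<in> F \<Longrightarrow> (\<lambda>n. bohr_avg \<xi> n u) \<longlonglongrightarrow> c \<xi>"
  shows "(\<lambda>n. (rms n (\<lambda>k. u k - trig_poly F b k))\<^sup>2)
           \<longlonglongrightarrow> q - (\<Sum>\<xi>\<in>F. (cmod (c \<xi>))\<^sup>2) + (\<Sum>\<xi>\<in>F. (cmod (b \<xi> - c \<xi>))\<^sup>2)"
  using assms
proof (induction F)
  case empty
  thus ?case by (simp add: trig_poly_def)
next
  case (insert \<xi> F)
  define v where "v = (\<lambda>k. u k - trig_poly F b k)"
  have IH: "(\<lambda>n. (rms n v)\<^sup>2) \<longlonglongrightarrow>
      q - (\<Sum>\<xi>\<in>F. (cmod (c \<xi>))\<^sup>2) + (\<Sum>\<xi>\<in>F. (cmod (b \<xi> - c \<xi>))\<^sup>2)"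
    using insert unfolding v_def by simp
  have "(\<lambda>n. bohr_avg \<xi> n u - bohr_avg \<xi> n (trig_poly F b)) \<longlonglongrightarrow> c \<xi> - (if \<xi> \<in> F then b \<xi> else 0)"
    using insert by (intro tendsto_diff bohr_avg_trig_poly) auto
  hence "(\<lambda>n. bohr_avg \<xi> n v) \<longlonglongrightarrow> c \<xi>"
    using insert.hyps by (simp add: v_def bohr_avg_diff[of _ _ u "trig_poly F b"])
  from rms_diff_character[OF _ IH this, of "b \<xi>"] insert show ?case
    by (simp add: v_def trig_poly_def algebra_simps)
qed

definition almost_periodic :: "complex set \<Rightarrow> (nat \<Rightarrow> complex) \<Rightarrow> bool" where
  "almost_periodic S u \<longleftrightarrow>
     (\<forall>\<epsilon>>0. \<exists>F b. finite F \<and> F \<subseteq> S \<and> asymp_rms_le (\<lambda>k. u k - trig_poly F b k) \<epsilon>)"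

lemma almost_periodicD:
  assumes "almost_periodic S u" "\<epsilon> > 0"
  shows "\<exists>F b. finite F \<and> F \<subseteq> S \<and> asymp_rms_le (\<lambda>k. u k - trig_poly F b k) \<epsilon>"
  using assms unfolding almost_periodic_def by blast

lemma almost_periodic_closed:
  assumes "\<And>\<epsilon>. \<epsilon> > 0 \<Longrightarrow> \<exists>v. almost_periodic S v \<and> asymp_rms_le (\<lambda>k. u k - v k) \<epsilon>"
  shows "almost_periodic S u"
  unfolding almost_periodic_def
proof (intro allI impI)
  fix \<epsilon> :: real assume "\<epsilon> > 0"
  then obtain v where v: "almost_periodic S v" "asymp_rms_le (\<lambda>k. u k - v k) (\<epsilon>/2)"
    using assms[of "\<epsilon>/2"] by auto
  obtain F b where F: "finite F" "F \<subseteq> S" "asymp_rms_le (\<lambda>k. v k - trig_poly F b k) (\<epsilon>/2)"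
    using almost_periodicD[OF v(1), of "\<epsilon>/2"] \<open>\<epsilon> > 0\<close> by auto
  have "asymp_rms_le (\<lambda>k. u k - trig_poly F b k) \<epsilon>"
    using asymp_rms_le_add[OF v(2) F(3)] by simp
  with F show "\<exists>F b. finite F \<and> F \<subseteq> S \<and> asymp_rms_le (\<lambda>k. u k - trig_poly F b k) \<epsilon>" by blast
qed

text \<open>
  A Fourier average is bounded by the quadratic mean, so the averages of \<open>u\<close> eventually stay close to the
  convergent averages of an approximating trigonometric polynomial.
\<close>

lemma almost_periodic_convergent:
  assumes "almost_periodic S u" "S \<subseteq> sphere 0 1" "cmod \<xi> = 1"
  shows "convergent (\<lambda>n. bohr_avg \<xi> n u)"
proof -
  have "Cauchy (\<lambda>n. bohr_avg \<xi> n u)"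
  proof (rule metric_CauchyI)
    fix e :: real assume e: "e > 0"
    then obtain F b where F: "finite F" "F \<subseteq> S" "asymp_rms_le (\<lambda>k. u k - trig_poly F b k) (e/8)"
      using almost_periodicD[OF assms(1), of "e/8"] by auto
    define L where "L = (if \<xi> \<in> F then b \<xi> else 0)"
    have "(\<lambda>n. bohr_avg \<xi> n (trig_poly F b)) \<longlonglongrightarrow> L"
      unfolding L_def using F assms by (intro bohr_avg_trig_poly) auto
    hence "\<forall>\<^sub>F n in sequentially. dist (bohr_avg \<xi> n (trig_poly F b)) L < e/4"
      using e by (intro tendstoD) auto
    moreover have "\<forall>\<^sub>F n in sequentially. rms n (\<lambda>k. u k - trig_poly F b k) < e/4"
      using asymp_rms_leD[OF F(3), of "e/4"] e by simp
    ultimately have "\<forall>\<^sub>F n in sequentially. dist (bohr_avg \<xi> n u) L < e/2"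
    proof eventually_elim
      case (elim n)
      have "cmod (bohr_avg \<xi> n u - bohr_avg \<xi> n (trig_poly F b)) \<le> rms n (\<lambda>k. u k - trig_poly F b k)"
        using bohr_avg_le_rms[OF assms(3), of n "\<lambda>k. u k - trig_poly F b k"]
          bohr_avg_diff[of \<xi> n u "trig_poly F b"] by simp
      with elim show ?case
        using dist_triangle[of "bohr_avg \<xi> n u" L "bohr_avg \<xi> n (trig_poly F b)"]
        by (simp add: dist_norm)
    qed
    then obtain N where N: "\<And>n. n \<ge> N \<Longrightarrow> dist (bohr_avg \<xi> n u) L < e/2"
      unfolding eventually_sequentially by blast
    show "\<exists>M. \<forall>m\<ge>M. \<forall>n\<ge>M. dist (bohr_avg \<xi> m u) (bohr_avg \<xi> n u) < e"
      using N dist_triangle_half_l by blast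
  qed
  thus ?thesis by (rule Cauchy_convergent)
qed

lemma bohr_limit_le:
  assumes v: "asymp_rms_le v a" and \<xi>: "cmod \<xi> = 1" and lim: "(\<lambda>n. bohr_avg \<xi> n v) \<longlonglongrightarrow> L"
  shows "cmod L \<le> a"
proof (rule field_le_epsilon)
  fix e :: real assume "0 < e"
  hence "\<forall>\<^sub>F n in sequentially. rms n v \<le> a + e" using v unfolding asymp_rms_le_def by blast
  hence "\<forall>\<^sub>F n in sequentially. cmod (bohr_avg \<xi> n v) \<le> a + e"
    by eventually_elim (rule order_trans[OF bohr_avg_le_rms[OF \<xi>]])
  thus "cmod L \<le> a + e" using tendsto_upperbound[OF tendsto_norm[OF lim]] by simp
qed

lemma almost_periodic_limit_zero:
  assumes "almost_periodic S u" "S \<subseteq> sphere 0 1" "cmod \<xi> = 1" "\<xi> \<notin> S"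
    and c: "(\<lambda>n. bohr_avg \<xi> n u) \<longlonglongrightarrow> c"
  shows "c = 0"
proof -
  have "cmod c \<le> e" if e0: "e > 0" for e
  proof -
    obtain F b where F: "finite F" "F \<subseteq> S" "asymp_rms_le (\<lambda>k. u k - trig_poly F b k) e"
      using almost_periodicD[OF assms(1) e0] by blast
    have "F \<subseteq> sphere 0 1" "\<xi> \<notin> F" using F(2) assms(2,4) by auto
    hence "(\<lambda>n. bohr_avg \<xi> n (trig_poly F b)) \<longlonglongrightarrow> 0"
      using bohr_avg_trig_poly[of F \<xi> b] F(1) assms(3) by simp
    from tendsto_diff[OF c this]
    have "(\<lambda>n. bohr_avg \<xi> n (\<lambda>k. u k - trig_poly F b k)) \<longlonglongrightarrow> c"
      by (simp add: bohr_avg_diff[of _ _ u "trig_poly F b"])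
    thus ?thesis by (rule bohr_limit_le[OF F(3) assms(3)])
  qed
  thus ?thesis using field_le_epsilon[of "cmod c" 0] by auto
qed

lemma bessel_mean:
  assumes "finite F" "F \<subseteq> sphere 0 1"
    and q: "(\<lambda>n. (rms n u)\<^sup>2) \<longlonglongrightarrow> q"
    and c: "\<And>\<xi>. \<xi> \<in> F \<Longrightarrow> (\<lambda>n. bohr_avg \<xi> n u) \<longlonglongrightarrow> c \<xi>"
  shows "(\<Sum>\<xi>\<in>F. (cmod (c \<xi>))\<^sup>2) \<le> q"
proof -
  have "(\<lambda>n. (rms n (\<lambda>k. u k - trig_poly F c k))\<^sup>2) \<longlonglongrightarrow> q - (\<Sum>\<xi>\<in>F. (cmod (c \<xi>))\<^sup>2)"
    using rms_diff_trig_poly[OF assms, of c] by simp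
  hence "0 \<le> q - (\<Sum>\<xi>\<in>F. (cmod (c \<xi>))\<^sup>2)"
    by (rule tendsto_lowerbound) auto
  thus ?thesis by simp
qed

text \<open>
  Forwards, a trigonometric polynomial close to \<open>u\<close> forces the coefficients on its frequency set to
  exhaust \<open>q\<close> up to a small error. Backwards, a finite \<open>F\<close> that nearly exhausts the sum
  makes the trigonometric polynomial with the Fourier coefficients of \<open>u\<close> close to \<open>u\<close>.
\<close>

lemma parseval_mean:
  assumes S: "S \<subseteq> sphere 0 1"
    and q: "(\<lambda>n. (rms n u)\<^sup>2) \<longlonglongrightarrow> q"
    and c: "\<And>\<xi>. \<xi> \<in> S \<Longrightarrow> (\<lambda>n. bohr_avg \<xi> n u) \<longlonglongrightarrow> c \<xi>"
  shows "almost_periodic S u \<longleftrightarrow>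
           ennreal q = (SUP F\<in>{F. finite F \<and> F \<subseteq> S}. \<Sum>\<xi>\<in>F. ennreal ((cmod (c \<xi>))\<^sup>2))"
    (is "_ \<longleftrightarrow> _ = ?S")
proof
  assume ap: "almost_periodic S u"
  show "ennreal q = ?S"
  proof (rule antisym)
    show "?S \<le> ennreal q"
    proof (rule SUP_least)
      fix F assume "F \<in> {F. finite F \<and> F \<subseteq> S}"
      hence "(\<Sum>\<xi>\<in>F. (cmod (c \<xi>))\<^sup>2) \<le> q"
        using S c by (intro bessel_mean[OF _ _ q]) auto
      thus "(\<Sum>\<xi>\<in>F. ennreal ((cmod (c \<xi>))\<^sup>2)) \<le> ennreal q"
        by (simp add: sum_ennreal ennreal_leI)
    qed
    show "ennreal q \<le> ?S"
    proof (rule ennreal_le_epsilon)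
      fix e :: real assume e: "0 < e"
      then obtain F b where F: "finite F" "F \<subseteq> S"
        "asymp_rms_le (\<lambda>k. u k - trig_poly F b k) (sqrt e)"
        using almost_periodicD[OF ap, of "sqrt e"] by auto
      define L where "L = q - (\<Sum>\<xi>\<in>F. (cmod (c \<xi>))\<^sup>2) + (\<Sum>\<xi>\<in>F. (cmod (b \<xi> - c \<xi>))\<^sup>2)"
      have "(\<lambda>n. (rms n (\<lambda>k. u k - trig_poly F b k))\<^sup>2) \<longlonglongrightarrow> L"
        unfolding L_def using F S c by (intro rms_diff_trig_poly[OF _ _ q]) auto
      hence "(\<lambda>n. sqrt ((rms n (\<lambda>k. u k - trig_poly F b k))\<^sup>2)) \<longlonglongrightarrow> sqrt L"
        by (rule tendsto_real_sqrt)
      hence "sqrt L \<le> sqrt e" using F(3) by (intro asymp_rms_le_limit) auto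
      moreover have "0 \<le> (\<Sum>\<xi>\<in>F. (cmod (b \<xi> - c \<xi>))\<^sup>2)" by (simp add: sum_nonneg)
      ultimately have "q \<le> (\<Sum>\<xi>\<in>F. (cmod (c \<xi>))\<^sup>2) + e" unfolding L_def by simp
      hence "ennreal q \<le> (\<Sum>\<xi>\<in>F. ennreal ((cmod (c \<xi>))\<^sup>2)) + ennreal e"
        using e by (simp add: sum_ennreal sum_nonneg ennreal_leI flip: ennreal_plus)
      also have "\<dots> \<le> ?S + ennreal e"
        using F by (intro add_right_mono SUP_upper) auto
      finally show "ennreal q \<le> ?S + ennreal e" .
    qed
  qed
next
  assume eq: "ennreal q = ?S"
  have q0: "0 \<le> q" by (rule tendsto_lowerbound[OF q]) auto
  show "almost_periodic S u"
    unfolding almost_periodic_def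
  proof (intro allI impI)
    fix \<epsilon> :: real assume e: "0 < \<epsilon>"
    have "\<exists>F. finite F \<and> F \<subseteq> S \<and> q - \<epsilon>\<^sup>2 \<le> (\<Sum>\<xi>\<in>F. (cmod (c \<xi>))\<^sup>2)"
    proof (cases "q - \<epsilon>\<^sup>2 \<le> 0")
      case True
      thus ?thesis by (intro exI[of _ "{}"]) simp
    next
      case False
      moreover from False have "0 < q" using zero_less_power[OF e, of 2] by linarith
      ultimately have "ennreal (q - \<epsilon>\<^sup>2) < ?S"
        using e by (subst eq[symmetric]) (auto intro!: ennreal_lessI)
      then obtain F where "finite F" "F \<subseteq> S" "ennreal (q - \<epsilon>\<^sup>2) < (\<Sum>\<xi>\<in>F. ennreal ((cmod (c \<xi>))\<^sup>2))"
        unfolding less_SUP_iff by auto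
      moreover from this have "q - \<epsilon>\<^sup>2 < (\<Sum>\<xi>\<in>F. (cmod (c \<xi>))\<^sup>2)"
        using False by (simp add: sum_ennreal ennreal_less_iff)
      ultimately show ?thesis by (meson less_imp_le)
    qed
    then obtain F where F: "finite F" "F \<subseteq> S" "q - \<epsilon>\<^sup>2 \<le> (\<Sum>\<xi>\<in>F. (cmod (c \<xi>))\<^sup>2)"
      by blast
    have "(\<lambda>n. (rms n (\<lambda>k. u k - trig_poly F c k))\<^sup>2) \<longlonglongrightarrow> q - (\<Sum>\<xi>\<in>F. (cmod (c \<xi>))\<^sup>2)"
      using rms_diff_trig_poly[OF F(1) _ q, of c c] F S c by force
    hence "(\<lambda>n. sqrt ((rms n (\<lambda>k. u k - trig_poly F c k))\<^sup>2)) \<longlonglongrightarrow> sqrt (q - (\<Sum>\<xi>\<in>F. (cmod (c \<xi>))\<^sup>2))"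
      by (rule tendsto_real_sqrt)
    hence "asymp_rms_le (\<lambda>k. u k - trig_poly F c k) \<epsilon>"
      using F(3) e by (intro limit_asymp_rms_le) (auto intro!: real_le_lsqrt)
    with F show "\<exists>F b. finite F \<and> F \<subseteq> S \<and> asymp_rms_le (\<lambda>k. u k - trig_poly F b k) \<epsilon>" by blast
  qed
qed

text \<open>
  Among all trigonometric polynomials on \<open>F\<close>, the Bessel identity is minimal at the Fourier coefficients.
\<close>

lemma trig_poly_best_approx:
  assumes F: "finite F" "F \<subseteq> sphere 0 1"
    and q: "(\<lambda>n. (rms n u)\<^sup>2) \<longlonglongrightarrow> q"
    and c: "\<And>\<xi>. \<xi> \<in> F \<Longrightarrow> (\<lambda>n. bohr_avg \<xi> n u) \<longlonglongrightarrow> c \<xi>"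
    and b: "asymp_rms_le (\<lambda>k. u k - trig_poly F b k) e"
  shows "asymp_rms_le (\<lambda>k. u k - trig_poly F c k) e"
proof -
  let ?L = "\<lambda>b. q - (\<Sum>\<xi>\<in>F. (cmod (c \<xi>))\<^sup>2) + (\<Sum>\<xi>\<in>F. (cmod (b \<xi> - c \<xi>))\<^sup>2)"
  have lim: "(\<lambda>n. rms n (\<lambda>k. u k - trig_poly F b k)) \<longlonglongrightarrow> sqrt (?L b)" for b
    using tendsto_real_sqrt[OF rms_diff_trig_poly[OF F q c, of b]] by simp
  have "sqrt (?L c) \<le> sqrt (?L b)" by (simp add: sum_nonneg)
  also have "\<dots> \<le> e" by (rule asymp_rms_le_limit[OF b lim])
  finally show ?thesis by (rule limit_asymp_rms_le[OF lim])
qed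

text \<open>
  Averaging the translates of \<open>u\<close> against \<open>\<xi>\<close> filters out every frequency but \<open>\<xi>\<close>. For a trigonometric
  polynomial this holds uniformly in the translation \<open>k\<close>. The error of the approximation is not
  increased, since averaging translates does not increase the seminorm. On the orbit of a
  point this says that the functions \<open>A\<^sub>n[f, \<xi>\<^sup>-\<^sup>1]\<close> converge in quadratic mean.
\<close>

lemma almost_periodic_shifted_avg:
  assumes ap: "almost_periodic S u" and S: "S \<subseteq> sphere 0 1" and \<xi>: "cmod \<xi> = 1"
    and c: "(\<lambda>n. bohr_avg \<xi> n u) \<longlonglongrightarrow> c" and e: "0 < e"
  shows "\<forall>\<^sub>F n in sequentially. asymp_rms_le (\<lambda>k. bohr_avg \<xi> n (\<lambda>j. u (k + j)) - c * \<xi> ^ k) e"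
proof -
  obtain F b where F: "finite F" "F \<subseteq> S" and b: "asymp_rms_le (\<lambda>k. u k - trig_poly F b k) (e/4)"
    using almost_periodicD[OF ap, of "e/4"] e by auto
  have Fs: "F \<subseteq> sphere 0 1" using F(2) S by blast
  define v where "v k = u k - trig_poly F b k" for k
  define \<delta> where "\<delta> \<eta> = (if \<eta> = \<xi> then 1 else 0 :: complex)" for \<eta>
  define b0 where "b0 = (if \<xi> \<in> F then b \<xi> else 0)"
  have b0: "b0 * \<xi> ^ k = (\<Sum>\<eta>\<in>F. b \<eta> * \<eta> ^ k * \<delta> \<eta>)" for k
    using F(1) by (simp add: b0_def \<delta>_def if_distrib cong: if_cong)
  have v: "asymp_rms_le v (e/4)" using b by (simp add: v_def[abs_def])
  have "(\<lambda>n. bohr_avg \<xi> n v) \<longlonglongrightarrow> c - b0"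
    unfolding v_def[abs_def] bohr_avg_diff b0_def
    using tendsto_diff[OF c bohr_avg_trig_poly[OF F(1) Fs \<xi>, of b]] by simp
  hence near: "cmod (c - b0) \<le> e/4" by (rule bohr_limit_le[OF v \<xi>])
  have "(\<lambda>n. \<Sum>\<eta>\<in>F. cmod (b \<eta>) * cmod (bohr_avg \<xi> n (\<lambda>j. \<eta> ^ j) - \<delta> \<eta>)) \<longlonglongrightarrow> (\<Sum>\<eta>\<in>F. cmod (b \<eta>) * cmod (\<delta> \<eta> - \<delta> \<eta>))"
    unfolding \<delta>_def using Fs by (intro tendsto_intros bohr_avg_character \<xi>) auto
  hence "\<forall>\<^sub>F n in sequentially. (\<Sum>\<eta>\<in>F. cmod (b \<eta>) * cmod (bohr_avg \<xi> n (\<lambda>j. \<eta> ^ j) - \<delta> \<eta>)) < e/4"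
    using e by (intro order_tendstoD(2)) auto
  thus ?thesis using eventually_gt_at_top[of 0]
  proof eventually_elim
    case (elim n)
    \<comment> \<open>the approximation error \<open>v\<close>, the convergence of the averages of the polynomial, and the error
      made by replacing its coefficient \<open>b0\<close> at \<open>\<xi>\<close> by the one of \<open>u\<close>\<close>
    have 1: "asymp_rms_le (\<lambda>k. bohr_avg \<xi> n (\<lambda>j. v (k + j))) (e/4)"
    proof -
      have "asymp_rms_le (\<lambda>k. \<Sum>j<n. (\<xi> powi (- int j) / of_nat n) * v (k + j))
              (\<Sum>j<n. cmod (\<xi> powi (- int j) / of_nat n) * (e/4))"
        by (intro asymp_rms_le_sum asymp_rms_le_scale asymp_rms_le_shift v) simp
      moreover have "(\<Sum>j<n. cmod (\<xi> powi (- int j) / of_nat n) * (e/4)) = e/4"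
        using elim(2) by (simp add: norm_divide cmod_unit_powi[OF \<xi>])
      ultimately have "asymp_rms_le (\<lambda>k. \<Sum>j<n. (\<xi> powi (- int j) / of_nat n) * v (k + j)) (e/4)"
        by (simp only:)
      thus ?thesis by (simp add: bohr_avg_def sum_divide_distrib)
    qed
    have 2: "asymp_rms_le (\<lambda>k. bohr_avg \<xi> n (\<lambda>j. trig_poly F b (k + j)) - b0 * \<xi> ^ k) (e/4)"
    proof (rule asymp_rms_le_bound)
      fix k
      have "bohr_avg \<xi> n (\<lambda>j. trig_poly F b (k + j)) = (\<Sum>\<eta>\<in>F. bohr_avg \<xi> n (\<lambda>j. b \<eta> * \<eta> ^ k * \<eta> ^ j))"
        by (simp add: trig_poly_def bohr_avg_sum power_add mult.assoc)
      also have "\<dots> = (\<Sum>\<eta>\<in>F. b \<eta> * \<eta> ^ k * bohr_avg \<xi> n (\<lambda>j. \<eta> ^ j))"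
        by (simp only: bohr_avg_scale)
      finally have "bohr_avg \<xi> n (\<lambda>j. trig_poly F b (k + j)) - b0 * \<xi> ^ k
          = (\<Sum>\<eta>\<in>F. b \<eta> * \<eta> ^ k * (bohr_avg \<xi> n (\<lambda>j. \<eta> ^ j) - \<delta> \<eta>))"
        by (simp add: b0 sum_subtractf right_diff_distrib)
      also have "cmod \<dots> \<le> (\<Sum>\<eta>\<in>F. cmod (b \<eta>) * cmod (bohr_avg \<xi> n (\<lambda>j. \<eta> ^ j) - \<delta> \<eta>))"
      proof (rule sum_norm_le)
        fix \<eta> assume "\<eta> \<in> F"
        hence "cmod \<eta> = 1" using Fs by auto
        thus "cmod (b \<eta> * \<eta> ^ k * (bohr_avg \<xi> n (\<lambda>j. \<eta> ^ j) - \<delta> \<eta>))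
            \<le> cmod (b \<eta>) * cmod (bohr_avg \<xi> n (\<lambda>j. \<eta> ^ j) - \<delta> \<eta>)"
          by (simp add: norm_mult norm_power)
      qed
      finally show "cmod (bohr_avg \<xi> n (\<lambda>j. trig_poly F b (k + j)) - b0 * \<xi> ^ k) \<le> e/4"
        using elim(1) by simp
    qed (use e in simp)
    have 3: "asymp_rms_le (\<lambda>k. (c - b0) * \<xi> ^ k) (e/4)"
      using near e by (intro asymp_rms_le_bound) (auto simp: norm_mult norm_power \<xi>)
    have eq: "bohr_avg \<xi> n (\<lambda>j. v (k + j)) + (bohr_avg \<xi> n (\<lambda>j. trig_poly F b (k + j)) - b0 * \<xi> ^ k)
        - (c - b0) * \<xi> ^ k = bohr_avg \<xi> n (\<lambda>j. u (k + j)) - c * \<xi> ^ k" for k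
      unfolding v_def bohr_avg_diff by (simp add: algebra_simps)
    have "asymp_rms_le (\<lambda>k. bohr_avg \<xi> n (\<lambda>j. u (k + j)) - c * \<xi> ^ k) (e/4 + e/4 + e/4)"
      using asymp_rms_le_diff[OF asymp_rms_le_add[OF 1 2] 3] unfolding eq .
    thus ?case by (rule asymp_rms_le_mono) (use e in simp)
  qed
qed


section \<open>The space of square integrable functions\<close>

lemma L2_measurable: "f \<in> L2 M \<Longrightarrow> f \<in> borel_measurable M"
  and L2_integrable_power2: "f \<in> L2 M \<Longrightarrow> integrable M (\<lambda>x. (cmod (f x))\<^sup>2)"
  by (auto simp: L2_def)

lemma L2_norm_nonneg [simp]: "0 \<le> L2_norm M f"
  by (simp add: L2_norm_def)

lemma L2_norm_power2: "(L2_norm M f)\<^sup>2 = (\<integral>x. (cmod (f x))\<^sup>2 \<partial>M)"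
  by (simp add: L2_norm_def)

lemma L2_add:
  assumes "f \<in> L2 M" "g \<in> L2 M"
  shows "(\<lambda>x. f x + g x) \<in> L2 M"
proof -
  have [measurable]: "f \<in> borel_measurable M" "g \<in> borel_measurable M"
    using assms L2_measurable by auto
  have "integrable M (\<lambda>x. 2 * (cmod (f x))\<^sup>2 + 2 * (cmod (g x))\<^sup>2)"
    using assms L2_integrable_power2 by (intro Bochner_Integration.integrable_add integrable_mult_right) auto
  hence "integrable M (\<lambda>x. (cmod (f x + g x))\<^sup>2)"
  proof (rule Bochner_Integration.integrable_bound)
    have "(cmod (f x + g x))\<^sup>2 \<le> 2 * (cmod (f x))\<^sup>2 + 2 * (cmod (g x))\<^sup>2" for x
    proof -
      have "(cmod (f x + g x))\<^sup>2 \<le> (cmod (f x) + cmod (g x))\<^sup>2"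
        by (intro power_mono norm_triangle_ineq) auto
      also have "\<dots> \<le> 2 * (cmod (f x))\<^sup>2 + 2 * (cmod (g x))\<^sup>2"
        using sum_squares_bound[of "cmod (f x)" "cmod (g x)"] by (simp add: power2_sum)
      finally show ?thesis .
    qed
    thus "AE x in M. norm ((cmod (f x + g x))\<^sup>2) \<le> norm (2 * (cmod (f x))\<^sup>2 + 2 * (cmod (g x))\<^sup>2)"
      by simp
  qed simp
  thus ?thesis by (simp add: L2_def)
qed

lemma L2_scale: "f \<in> L2 M \<Longrightarrow> (\<lambda>x. c * f x) \<in> L2 M"
  by (auto simp: L2_def norm_mult power_mult_distrib)

lemma L2_diff:
  assumes "f \<in> L2 M" "g \<in> L2 M"
  shows "(\<lambda>x. f x - g x) \<in> L2 M"
  using L2_add[OF assms(1) L2_scale[OF assms(2), of "-1"]] by simp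

lemma L2_zero [simp]: "(\<lambda>x. 0) \<in> L2 M"
  by (simp add: L2_def)

lemma L2_sum:
  assumes "\<And>i. i \<in> A \<Longrightarrow> f i \<in> L2 M"
  shows "(\<lambda>x. \<Sum>i\<in>A. f i x) \<in> L2 M"
  using assms by (induction A rule: infinite_finite_induct) (auto intro: L2_add)

lemma L2_integrable_mult:
  assumes "f \<in> L2 M" "g \<in> L2 M"
  shows "integrable M (\<lambda>x. cmod (f x) * cmod (g x))"
proof -
  have [measurable]: "f \<in> borel_measurable M" "g \<in> borel_measurable M"
    using assms L2_measurable by auto
  have "integrable M (\<lambda>x. (cmod (f x))\<^sup>2 + (cmod (g x))\<^sup>2)"
    using assms L2_integrable_power2 by (intro Bochner_Integration.integrable_add) auto
  thus ?thesis
  proof (rule Bochner_Integration.integrable_bound)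
    have "cmod (f x) * cmod (g x) \<le> (cmod (f x))\<^sup>2 + (cmod (g x))\<^sup>2" for x
    proof -
      have "0 \<le> cmod (f x) * cmod (g x)" by simp
      thus ?thesis using sum_squares_bound[of "cmod (f x)" "cmod (g x)"] by linarith
    qed
    thus "AE x in M. norm (cmod (f x) * cmod (g x)) \<le> norm ((cmod (f x))\<^sup>2 + (cmod (g x))\<^sup>2)"
      by simp
  qed simp
qed

lemma L2_inner_integrable:
  assumes "f \<in> L2 M" "g \<in> L2 M"
  shows "integrable M (\<lambda>x. f x * cnj (g x))"
proof -
  have [measurable]: "f \<in> borel_measurable M" "g \<in> borel_measurable M"
    using assms L2_measurable by auto
  have "(\<lambda>x. cnj (g x)) \<in> borel_measurable M"
    by (rule measurable_compose[OF \<open>g \<in> borel_measurable M\<close>])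
       (intro borel_measurable_continuous_onI continuous_intros)
  thus ?thesis
    by (intro Bochner_Integration.integrable_bound[OF L2_integrable_mult[OF assms]])
       (auto simp: norm_mult)
qed

lemma L2_cauchy_schwarz_abs:
  assumes "f \<in> L2 M" "g \<in> L2 M"
  shows "(\<integral>x. cmod (f x) * cmod (g x) \<partial>M) \<le> L2_norm M f * L2_norm M g"
proof -
  have [measurable]: "f \<in> borel_measurable M" "g \<in> borel_measurable M"
    using assms L2_measurable by auto
  define I where "I = (\<integral>x. cmod (f x) * cmod (g x) \<partial>M)"
  have I0: "0 \<le> I" by (simp add: I_def)
  have nn: "(\<integral>\<^sup>+x. ennreal ((cmod (h x))\<^sup>2) \<partial>M) = ennreal ((L2_norm M h)\<^sup>2)" if "h \<in> L2 M" for h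
    using nn_integral_eq_integral[OF L2_integrable_power2[OF that]]
    by (simp add: L2_norm_power2)
  have "(\<integral>\<^sup>+x. ennreal (cmod (f x)) * ennreal (cmod (g x)) \<partial>M) = ennreal I"
    using nn_integral_eq_integral[OF L2_integrable_mult[OF assms]]
    by (simp add: I_def ennreal_mult)
  hence "ennreal (I\<^sup>2) \<le> ennreal ((L2_norm M f)\<^sup>2 * (L2_norm M g)\<^sup>2)"
    using Cauchy_Schwarz_nn_integral[of "\<lambda>x. ennreal (cmod (f x))" M "\<lambda>x. ennreal (cmod (g x))"]
    by (simp add: nn assms ennreal_power I0 ennreal_mult)
  hence "I\<^sup>2 \<le> (L2_norm M f * L2_norm M g)\<^sup>2"
    by (simp add: power_mult_distrib)
  thus ?thesis unfolding I_def[symmetric] by (rule power2_le_imp_le) simp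
qed

lemma L2_cauchy_schwarz:
  assumes "f \<in> L2 M" "g \<in> L2 M"
  shows "cmod (L2_inner M f g) \<le> L2_norm M f * L2_norm M g"
proof -
  have "cmod (L2_inner M f g) \<le> (\<integral>x. cmod (f x * cnj (g x)) \<partial>M)"
    unfolding L2_inner_def by (rule integral_norm_bound)
  also have "\<dots> \<le> L2_norm M f * L2_norm M g"
    using L2_cauchy_schwarz_abs[OF assms] by (simp add: norm_mult)
  finally show ?thesis .
qed

lemma L2_triangle:
  assumes "f \<in> L2 M" "g \<in> L2 M"
  shows "L2_norm M (\<lambda>x. f x + g x) \<le> L2_norm M f + L2_norm M g"
proof (rule power2_le_imp_le)
  have int: "integrable M (\<lambda>x. (cmod (f x))\<^sup>2 + 2 * (cmod (f x) * cmod (g x)) + (cmod (g x))\<^sup>2)"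
    using assms by (intro Bochner_Integration.integrable_add integrable_mult_right
        L2_integrable_mult L2_integrable_power2)
  have "(L2_norm M (\<lambda>x. f x + g x))\<^sup>2
      \<le> (\<integral>x. (cmod (f x))\<^sup>2 + 2 * (cmod (f x) * cmod (g x)) + (cmod (g x))\<^sup>2 \<partial>M)"
    unfolding L2_norm_power2
  proof (rule integral_mono[OF L2_integrable_power2[OF L2_add[OF assms]] int])
    fix x
    have "(cmod (f x + g x))\<^sup>2 \<le> (cmod (f x) + cmod (g x))\<^sup>2"
      by (intro power_mono norm_triangle_ineq) auto
    thus "(cmod (f x + g x))\<^sup>2 \<le> (cmod (f x))\<^sup>2 + 2 * (cmod (f x) * cmod (g x)) + (cmod (g x))\<^sup>2"
      by (simp add: power2_sum)
  qed
  also have "\<dots> = (L2_norm M f)\<^sup>2 + 2 * (\<integral>x. cmod (f x) * cmod (g x) \<partial>M) + (L2_norm M g)\<^sup>2"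
    using assms by (simp add: L2_norm_power2 L2_integrable_power2 L2_integrable_mult)
  also have "\<dots> \<le> (L2_norm M f + L2_norm M g)\<^sup>2"
    using L2_cauchy_schwarz_abs[OF assms] by (simp add: power2_sum)
  finally show "(L2_norm M (\<lambda>x. f x + g x))\<^sup>2 \<le> (L2_norm M f + L2_norm M g)\<^sup>2" .
qed simp

lemma L2_norm_scale: "L2_norm M (\<lambda>x. c * f x) = cmod c * L2_norm M f"
  by (simp add: L2_norm_def norm_mult power_mult_distrib real_sqrt_mult)

lemma L2_norm_minus_commute: "L2_norm M (\<lambda>x. f x - g x) = L2_norm M (\<lambda>x. g x - f x)"
  by (simp add: L2_norm_def norm_minus_commute)

lemma L2_triangle_diff:
  assumes "f \<in> L2 M" "g \<in> L2 M" "h \<in> L2 M"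
  shows "L2_norm M (\<lambda>x. f x - h x) \<le> L2_norm M (\<lambda>x. f x - g x) + L2_norm M (\<lambda>x. g x - h x)"
  using L2_triangle[OF L2_diff[OF assms(1,2)] L2_diff[OF assms(2,3)]] by simp

lemma L2_norm_sum_le:
  assumes "\<And>i. i \<in> A \<Longrightarrow> f i \<in> L2 M"
  shows "L2_norm M (\<lambda>x. \<Sum>i\<in>A. f i x) \<le> (\<Sum>i\<in>A. L2_norm M (f i))"
  using assms
proof (induction A rule: infinite_finite_induct)
  case (insert a A)
  have "L2_norm M (\<lambda>x. f a x + (\<Sum>i\<in>A. f i x)) \<le> L2_norm M (f a) + L2_norm M (\<lambda>x. \<Sum>i\<in>A. f i x)"
    using insert.prems by (intro L2_triangle L2_sum) auto
  thus ?case using insert by simp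
qed (simp_all add: L2_norm_def)

lemma L2_norm_cong_AE:
  assumes "f \<in> borel_measurable M" "g \<in> borel_measurable M" "AE x in M. f x = g x"
  shows "L2_norm M f = L2_norm M g"
proof -
  have "(\<integral>x. (cmod (f x))\<^sup>2 \<partial>M) = (\<integral>x. (cmod (g x))\<^sup>2 \<partial>M)"
    using assms by (intro integral_cong_AE) (auto elim: eventually_mono)
  thus ?thesis by (simp add: L2_norm_def)
qed

lemma L2_norm_eq_0_iff:
  assumes "f \<in> L2 M"
  shows "L2_norm M f = 0 \<longleftrightarrow> (AE x in M. f x = 0)"
proof -
  have "(\<integral>x. (cmod (f x))\<^sup>2 \<partial>M) = 0 \<longleftrightarrow> (AE x in M. (cmod (f x))\<^sup>2 = 0)"
    by (rule integral_nonneg_eq_0_iff_AE[OF L2_integrable_power2[OF assms]]) auto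
  thus ?thesis by (simp add: L2_norm_def)
qed

lemma L2_inner_self: "L2_inner M f f = of_real ((L2_norm M f)\<^sup>2)"
  unfolding L2_inner_def L2_norm_power2
  by (simp only: complex_norm_square[symmetric] integral_complex_of_real)

lemma L2_inner_diff_right:
  assumes "f \<in> L2 M" "g \<in> L2 M" "h \<in> L2 M"
  shows "L2_inner M f (\<lambda>x. g x - h x) = L2_inner M f g - L2_inner M f h"
  unfolding L2_inner_def right_diff_distrib complex_cnj_diff
  by (intro Bochner_Integration.integral_diff L2_inner_integrable assms)

lemma L2_inner_sum_right:
  assumes "f \<in> L2 M" "\<And>i. i \<in> A \<Longrightarrow> g i \<in> L2 M"
  shows "L2_inner M f (\<lambda>x. \<Sum>i\<in>A. g i x) = (\<Sum>i\<in>A. L2_inner M f (g i))"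
  unfolding L2_inner_def cnj_sum sum_distrib_left
  by (intro Bochner_Integration.integral_sum L2_inner_integrable assms)

context prob_space
begin

lemma L2_bounded:
  assumes "f \<in> borel_measurable M" "\<And>x. cmod (f x) \<le> B"
  shows "f \<in> L2 M"
proof -
  have "integrable M (\<lambda>x. (cmod (f x))\<^sup>2)"
  proof (rule integrable_const_bound)
    show "AE x in M. norm ((cmod (f x))\<^sup>2) \<le> B\<^sup>2"
      using assms(2) by (auto intro!: power_mono)
  qed (use assms in measurable)
  thus ?thesis using assms by (simp add: L2_def)
qed

lemma L2_norm_le_bound:
  assumes "f \<in> borel_measurable M" "\<And>x. cmod (f x) \<le> B"
  shows "L2_norm M f \<le> B"
proof -
  have B: "0 \<le> B" using assms(2) norm_ge_zero order_trans by blast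
  have "(\<integral>x. (cmod (f x))\<^sup>2 \<partial>M) \<le> (\<integral>x. B\<^sup>2 \<partial>M)"
    using L2_integrable_power2[OF L2_bounded[OF assms]] assms(2)
    by (intro integral_mono) (auto intro!: power_mono)
  hence "(L2_norm M f)\<^sup>2 \<le> B\<^sup>2" by (simp add: L2_norm_power2 prob_space)
  thus ?thesis using B by (rule power2_le_imp_le)
qed

lemma L2_const: "(\<lambda>x. c) \<in> L2 M"
  by (rule L2_bounded) auto

lemma L2_imp_integrable:
  assumes "f \<in> L2 M"
  shows "integrable M f"
  using L2_inner_integrable[OF assms L2_const[of 1]] by simp

lemma L1_le_L2_norm:
  assumes "f \<in> L2 M"
  shows "(\<integral>x. cmod (f x) \<partial>M) \<le> L2_norm M f"
  using L2_cauchy_schwarz_abs[OF assms L2_const[of 1]] by (simp add: L2_norm_def prob_space)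

lemma L2_dominated:
  assumes [measurable]: "h \<in> borel_measurable M" and "\<And>n. g n \<in> L2 M" "w \<in> L2 M"
    and bound: "\<And>n x. cmod (g n x) \<le> cmod (w x)"
    and lim: "\<And>x. (\<lambda>n. g n x) \<longlonglongrightarrow> h x"
  shows "h \<in> L2 M" "(\<lambda>n. L2_norm M (\<lambda>x. h x - g n x)) \<longlonglongrightarrow> 0"
proof -
  have [measurable]: "g n \<in> borel_measurable M" "w \<in> borel_measurable M" for n
    by (rule L2_measurable[OF assms(2)], rule L2_measurable[OF assms(3)])
  have hw: "cmod (h x) \<le> cmod (w x)" for x
    by (rule tendsto_upperbound[OF tendsto_norm[OF lim]]) (use bound in auto)
  have "integrable M (\<lambda>x. (cmod (h x))\<^sup>2)"
    by (rule Bochner_Integration.integrable_bound[OF L2_integrable_power2[OF \<open>w \<in> L2 M\<close>]])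
       (auto intro!: power_mono hw)
  thus "h \<in> L2 M" by (simp add: L2_def)
  have "(\<lambda>n. \<integral>x. (cmod (h x - g n x))\<^sup>2 \<partial>M) \<longlonglongrightarrow> (\<integral>x. 0 \<partial>M)"
  proof (rule integral_dominated_convergence)
    show "integrable M (\<lambda>x. 4 * (cmod (w x))\<^sup>2)"
      using L2_integrable_power2[OF \<open>w \<in> L2 M\<close>] by simp
    show "AE x in M. (\<lambda>n. (cmod (h x - g n x))\<^sup>2) \<longlonglongrightarrow> 0"
    proof (rule AE_I2)
      fix x
      have "(\<lambda>n. (cmod (h x - g n x))\<^sup>2) \<longlonglongrightarrow> (cmod (h x - h x))\<^sup>2"
        by (intro tendsto_intros lim)
      thus "(\<lambda>n. (cmod (h x - g n x))\<^sup>2) \<longlonglongrightarrow> 0" by simp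
    qed
    fix n
    have "(cmod (h x - g n x))\<^sup>2 \<le> 4 * (cmod (w x))\<^sup>2" for x
    proof -
      have "cmod (h x - g n x) \<le> cmod (w x) + cmod (w x)"
        using norm_triangle_ineq4[of "h x" "g n x"] hw[of x] bound[of n x] by linarith
      hence "(cmod (h x - g n x))\<^sup>2 \<le> (2 * cmod (w x))\<^sup>2" by (intro power_mono) auto
      thus ?thesis by (simp add: power_mult_distrib)
    qed
    thus "AE x in M. norm ((cmod (h x - g n x))\<^sup>2) \<le> 4 * (cmod (w x))\<^sup>2" by simp
  qed auto
  hence "(\<lambda>n. sqrt (\<integral>x. (cmod (h x - g n x))\<^sup>2 \<partial>M)) \<longlonglongrightarrow> sqrt 0"
    by (intro tendsto_real_sqrt) simp
  thus "(\<lambda>n. L2_norm M (\<lambda>x. h x - g n x)) \<longlonglongrightarrow> 0" by (simp add: L2_norm_def)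
qed

text \<open>
  The Riesz--Fischer theorem. A Cauchy sequence in \<open>L\<^sup>2\<close> is Cauchy in \<open>L\<^sup>1\<close> since the measure is a
  probability, so a subsequence converges almost everywhere; Fatou's lemma then upgrades the pointwise limit
  to an \<open>L\<^sup>2\<close> limit.
\<close>

lemma L2_complete:
  assumes g: "\<And>n. g n \<in> L2 M"
    and cauchy: "\<And>e. e > 0 \<Longrightarrow> \<exists>N. \<forall>m\<ge>N. \<forall>n\<ge>N. L2_norm M (\<lambda>x. g m x - g n x) < e"
  shows "\<exists>h\<in>L2 M. (\<lambda>n. L2_norm M (\<lambda>x. g n x - h x)) \<longlonglongrightarrow> 0"
proof -
  have gm [measurable]: "g n \<in> borel_measurable M" for n
    using g L2_measurable by auto
  obtain r where r: "strict_mono r" "AE x in M. Cauchy (\<lambda>i. g (r i) x)"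
  proof (rule cauchy_L1_AE_cauchy_subseq)
    show "integrable M (g n)" for n by (rule L2_imp_integrable[OF g])
    fix e :: real assume "e > 0"
    then obtain N where "\<forall>m\<ge>N. \<forall>n\<ge>N. L2_norm M (\<lambda>x. g m x - g n x) < e"
      using cauchy by blast
    thus "\<exists>N. \<forall>i\<ge>N. \<forall>j\<ge>N. (\<integral>x. norm (g i x - g j x) \<partial>M) < e"
      using L1_le_L2_norm[OF L2_diff[OF g g]] by (meson le_less_trans)
  qed blast
  define h where "h x = lim (\<lambda>i. g (r i) x)" for x
  have [measurable]: "h \<in> borel_measurable M" unfolding h_def by measurable
  have lim: "AE x in M. (\<lambda>i. g (r i) x) \<longlonglongrightarrow> h x"
    using r(2) by eventually_elim (simp add: h_def Cauchy_convergent convergent_LIMSEQ_iff[symmetric])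
  have close: "(\<integral>\<^sup>+x. ennreal ((cmod (g n x - h x))\<^sup>2) \<partial>M) \<le> ennreal (e\<^sup>2)"
    if N: "\<forall>m\<ge>N. \<forall>n\<ge>N. L2_norm M (\<lambda>x. g m x - g n x) < e" and n: "N \<le> n" for e N n
  proof -
    have "(\<integral>\<^sup>+x. ennreal ((cmod (g n x - h x))\<^sup>2) \<partial>M)
        = (\<integral>\<^sup>+x. liminf (\<lambda>i. ennreal ((cmod (g n x - g (r i) x))\<^sup>2)) \<partial>M)"
    proof (rule nn_integral_cong_AE, use lim in eventually_elim)
      case (elim x)
      have "(\<lambda>i. ennreal ((cmod (g n x - g (r i) x))\<^sup>2)) \<longlonglongrightarrow> ennreal ((cmod (g n x - h x))\<^sup>2)"
        by (intro tendsto_intros elim tendsto_ennrealI)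
      from lim_imp_Liminf[OF sequentially_bot this] show ?case by simp
    qed
    also have "\<dots> \<le> liminf (\<lambda>i. \<integral>\<^sup>+x. ennreal ((cmod (g n x - g (r i) x))\<^sup>2) \<partial>M)"
      by (rule nn_integral_liminf) measurable
    also have "\<dots> \<le> ennreal (e\<^sup>2)"
    proof (rule Liminf_le)
      show "\<forall>\<^sub>F i in sequentially. (\<integral>\<^sup>+x. ennreal ((cmod (g n x - g (r i) x))\<^sup>2) \<partial>M) \<le> ennreal (e\<^sup>2)"
        using eventually_ge_at_top[of N]
      proof eventually_elim
        case (elim i)
        have "N \<le> r i" using elim seq_suble[OF r(1), of i] by simp
        hence "L2_norm M (\<lambda>x. g n x - g (r i) x) \<le> e" using N n by (simp add: less_imp_le)
        hence "(L2_norm M (\<lambda>x. g n x - g (r i) x))\<^sup>2 \<le> e\<^sup>2" by (intro power_mono) auto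
        thus ?case
          using nn_integral_eq_integral[OF L2_integrable_power2[OF L2_diff[OF g[of n] g[of "r i"]]]]
          by (simp add: L2_norm_power2 ennreal_leI)
      qed
    qed simp
    finally show ?thesis .
  qed
  have diffL2: "(\<lambda>x. g n x - h x) \<in> L2 M" if "(\<integral>\<^sup>+x. ennreal ((cmod (g n x - h x))\<^sup>2) \<partial>M) \<le> ennreal (e\<^sup>2)" for n e
    using that by (auto simp: L2_def integrable_iff_bounded intro: le_less_trans)
  obtain N where N: "\<forall>m\<ge>N. \<forall>n\<ge>N. L2_norm M (\<lambda>x. g m x - g n x) < 1"
    using cauchy[of 1] by auto
  have "(\<lambda>x. g N x - h x) \<in> L2 M"
    using close[OF N order_refl] by (rule diffL2)
  from L2_diff[OF g[of N] this] have h: "h \<in> L2 M" by (simp only: diff_diff_eq2 add_diff_cancel_left' )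
  moreover have "(\<lambda>n. L2_norm M (\<lambda>x. g n x - h x)) \<longlonglongrightarrow> 0"
  proof (rule LIMSEQ_I)
    fix e :: real assume e: "e > 0"
    then obtain N where N: "\<forall>m\<ge>N. \<forall>n\<ge>N. L2_norm M (\<lambda>x. g m x - g n x) < e/2"
      using cauchy[of "e/2"] by auto
    have le: "L2_norm M (\<lambda>x. g n x - h x) \<le> e/2" if "N \<le> n" for n
    proof -
      have "(\<integral>\<^sup>+x. ennreal ((cmod (g n x - h x))\<^sup>2) \<partial>M) = ennreal ((L2_norm M (\<lambda>x. g n x - h x))\<^sup>2)"
        unfolding L2_norm_power2
        by (rule nn_integral_eq_integral[OF L2_integrable_power2[OF L2_diff[OF g[of n] h]]]) simp
      with close[OF N that] have "ennreal ((L2_norm M (\<lambda>x. g n x - h x))\<^sup>2) \<le> ennreal ((e/2)\<^sup>2)"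
        by (simp only:)
      hence "(L2_norm M (\<lambda>x. g n x - h x))\<^sup>2 \<le> (e/2)\<^sup>2"
        by (simp only: ennreal_le_iff zero_le_power2)
      thus ?thesis by (rule power2_le_imp_le) (use e in simp)
    qed
    show "\<exists>no. \<forall>n\<ge>no. norm (L2_norm M (\<lambda>x. g n x - h x) - 0) < e"
    proof (intro exI[of _ N] allI impI)
      fix n assume "N \<le> n"
      from le[OF this] show "norm (L2_norm M (\<lambda>x. g n x - h x) - 0) < e"
        using e by simp
    qed
  qed
  ultimately show ?thesis by blast
qed

end

subsection \<open>Density of continuous functions\<close>

definition L2_approx_continuous :: "'a::metric_space measure \<Rightarrow> ('a \<Rightarrow> complex) \<Rightarrow> bool" where
  "L2_approx_continuous M h \<longleftrightarrow> h \<in> L2 M \<and>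
     (\<forall>e>0. \<exists>f :: 'a \<Rightarrow>\<^sub>C complex. L2_norm M (\<lambda>x. h x - f x) < e)"

locale borel_prob_space = prob_space M for M :: "'a::metric_space measure" +
  assumes sets_borel: "sets M = sets borel"
begin

lemma space_UNIV [simp]: "space M = UNIV"
  using sets_eq_imp_space_eq[OF sets_borel] by simp

lemma continuous_measurable:
  "continuous_on UNIV f \<Longrightarrow> f \<in> borel_measurable M"
  using borel_measurable_continuous_onI sets_borel measurable_cong_sets by blast

lemma bcontfun_L2 [intro, simp]: "apply_bcontfun (f :: 'a \<Rightarrow>\<^sub>C complex) \<in> L2 M"
  by (rule L2_bounded[OF continuous_measurable norm_bounded]) simp

lemma L2_approx_continuous_lim:
  assumes "h \<in> L2 M" "\<And>n. L2_approx_continuous M (g n)"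
    and "(\<lambda>n. L2_norm M (\<lambda>x. h x - g n x)) \<longlonglongrightarrow> 0"
  shows "L2_approx_continuous M h"
  unfolding L2_approx_continuous_def
proof (intro conjI allI impI assms(1))
  fix e :: real assume e: "0 < e"
  hence "\<forall>\<^sub>F n in sequentially. L2_norm M (\<lambda>x. h x - g n x) < e/2"
    using order_tendstoD(2)[OF assms(3), of "e/2"] by simp
  then obtain n where n: "L2_norm M (\<lambda>x. h x - g n x) < e/2"
    using eventually_happens by force
  have gn: "g n \<in> L2 M" using assms(2) L2_approx_continuous_def by blast
  obtain f :: "'a \<Rightarrow>\<^sub>C complex" where f: "L2_norm M (\<lambda>x. g n x - f x) < e/2"
    using assms(2)[of n] e unfolding L2_approx_continuous_def by (meson half_gt_zero)
  have "L2_norm M (\<lambda>x. h x - f x) < e"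
    using L2_triangle_diff[OF assms(1) gn bcontfun_L2[of f]] n f by linarith
  thus "\<exists>f :: 'a \<Rightarrow>\<^sub>C complex. L2_norm M (\<lambda>x. h x - f x) < e" by blast
qed

lemma L2_approx_continuous_bcontfun: "L2_approx_continuous M (apply_bcontfun f)"
  unfolding L2_approx_continuous_def
  by (auto simp: L2_norm_def intro!: exI[of _ f])

lemma L2_approx_continuous_add:
  assumes "L2_approx_continuous M g" "L2_approx_continuous M h"
  shows "L2_approx_continuous M (\<lambda>x. g x + h x)"
  unfolding L2_approx_continuous_def
proof (intro conjI allI impI)
  have gh: "g \<in> L2 M" "h \<in> L2 M" using assms L2_approx_continuous_def by auto
  thus "(\<lambda>x. g x + h x) \<in> L2 M" by (rule L2_add)
  fix e :: real assume e: "0 < e"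
  obtain f1 f2 :: "'a \<Rightarrow>\<^sub>C complex" where f: "L2_norm M (\<lambda>x. g x - f1 x) < e/2"
      "L2_norm M (\<lambda>x. h x - f2 x) < e/2"
    using assms e unfolding L2_approx_continuous_def by (meson half_gt_zero)
  have "L2_norm M (\<lambda>x. (g x - f1 x) + (h x - f2 x)) < e"
    using L2_triangle[OF L2_diff[OF gh(1) bcontfun_L2[of f1]] L2_diff[OF gh(2) bcontfun_L2[of f2]]] f
    by linarith
  hence "L2_norm M (\<lambda>x. g x + h x - (f1 + f2) x) < e" by (simp add: algebra_simps)
  thus "\<exists>f :: 'a \<Rightarrow>\<^sub>C complex. L2_norm M (\<lambda>x. g x + h x - f x) < e" by blast
qed

lemma L2_approx_continuous_scale:
  assumes "L2_approx_continuous M g"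
  shows "L2_approx_continuous M (\<lambda>x. c * g x)"
  unfolding L2_approx_continuous_def
proof (intro conjI allI impI)
  have g: "g \<in> L2 M" using assms L2_approx_continuous_def by auto
  thus "(\<lambda>x. c * g x) \<in> L2 M" by (rule L2_scale)
  fix e :: real assume e: "0 < e"
  have pos: "0 < cmod c + 1" by (simp add: add_nonneg_pos)
  hence "0 < e / (cmod c + 1)" using e by simp
  then obtain f :: "'a \<Rightarrow>\<^sub>C complex" where f: "L2_norm M (\<lambda>x. g x - f x) < e / (cmod c + 1)"
    using assms unfolding L2_approx_continuous_def by blast
  have "(\<lambda>x. c * f x) \<in> bcontfun"
    by (rule bcontfun_normI[of _ "cmod c * norm f"])
       (auto intro!: continuous_intros mult_left_mono simp: norm_mult norm_bounded)
  then obtain f' where f': "(\<lambda>x. c * f x) = apply_bcontfun f'" by (rule bcontfunE)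
  have "L2_norm M (\<lambda>x. c * g x - c * f x) = cmod c * L2_norm M (\<lambda>x. g x - f x)"
    unfolding right_diff_distrib[symmetric] by (rule L2_norm_scale)
  also have "\<dots> \<le> (cmod c + 1) * L2_norm M (\<lambda>x. g x - f x)" by (intro mult_right_mono) auto
  also have "\<dots> < e" using f pos by (simp add: pos_less_divide_eq mult.commute)
  finally have "L2_norm M (\<lambda>x. c * g x - f' x) < e" by (simp add: f'[symmetric] fun_cong[OF f', symmetric])
  thus "\<exists>f :: 'a \<Rightarrow>\<^sub>C complex. L2_norm M (\<lambda>x. c * g x - f x) < e" by blast
qed

lemma L2_approx_continuous_sum:
  assumes "\<And>i. i \<in> A \<Longrightarrow> L2_approx_continuous M (f i)"
  shows "L2_approx_continuous M (\<lambda>x. \<Sum>i\<in>A. f i x)"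
proof -
  have z: "L2_approx_continuous M (\<lambda>x. 0)"
    using L2_approx_continuous_bcontfun[of 0] by (simp add: zero_bcontfun.rep_eq)
  show ?thesis
    using assms
    by (induction A rule: infinite_finite_induct) (auto simp: z intro: L2_approx_continuous_add)
qed

text \<open>
  The functions \<open>max 0 (1 - n * infdist x A)\<close> decrease to the indicator of \<open>A\<close>.
\<close>

lemma L2_approx_continuous_closed:
  assumes "closed A"
  shows "L2_approx_continuous M (indicator A :: 'a \<Rightarrow> complex)"
proof (cases "A = {}")
  case True
  hence eq: "(indicator A :: 'a \<Rightarrow> complex) = apply_bcontfun 0"
    by (auto simp: zero_bcontfun.rep_eq)
  show ?thesis unfolding eq by (rule L2_approx_continuous_bcontfun)
next
  case False
  define g where "g n x = complex_of_real (max 0 (1 - real n * infdist x A))" for n :: nat and x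
  have g1: "cmod (g n x) \<le> 1" for n x
    by (simp add: g_def infdist_nonneg)
  have cont: "continuous_on UNIV (g n)" for n
    unfolding g_def by (intro continuous_intros)
  have "g n \<in> bcontfun" for n by (rule bcontfun_normI[OF cont g1])
  hence ap: "L2_approx_continuous M (g n)" for n
    by (metis L2_approx_continuous_bcontfun bcontfunE)
  have lim: "(\<lambda>n. g n x) \<longlonglongrightarrow> indicator A x" for x
  proof (cases "x \<in> A")
    case True
    thus ?thesis by (simp add: g_def)
  next
    case nA: False
    hence pos: "0 < infdist x A"
      using assms False by (simp add: infdist_pos_not_in_closed)
    obtain N :: nat where N: "1 / infdist x A < N" using reals_Archimedean2 by blast
    have "\<forall>\<^sub>F n in sequentially. g n x = 0"
      using eventually_ge_at_top[of N]
    proof eventually_elim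
      case (elim n)
      hence "1 / infdist x A \<le> real n" using N by linarith
      hence "1 \<le> real n * infdist x A" using pos by (simp add: pos_divide_le_eq)
      thus ?case by (simp add: g_def)
    qed
    thus ?thesis using nA by (simp add: tendsto_eventually)
  qed
  have "indicator A \<in> borel_measurable M"
    using assms by (intro borel_measurable_indicator) (simp add: sets_borel)
  note dom = L2_dominated[OF this _ L2_const[of 1], of g, OF _ _ lim]
  have gL2: "g n \<in> L2 M" for n using ap L2_approx_continuous_def by blast
  show ?thesis
    by (rule L2_approx_continuous_lim[OF dom(1) ap dom(2)]) (use gL2 g1 in auto)
qed

text \<open>
  Closed sets are stable under intersection and generate the Borel sets, and the sets with approximable
  indicator form a Dynkin system.
\<close>

lemma L2_approx_continuous_indicator:
  assumes "A \<in> sets M"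
  shows "L2_approx_continuous M (indicator A :: 'a \<Rightarrow> complex)"
proof -
  have "sets M = sigma_sets UNIV (Collect closed)"
    by (simp add: sets_borel borel_eq_closed)
  hence A: "A \<in> sigma_sets UNIV (Collect closed)" using assms by simp
  have "A \<in> sets M \<and> L2_approx_continuous M (indicator A :: 'a \<Rightarrow> complex)"
  proof (rule sigma_sets_induct_disjoint[OF _ _ A, where P = "\<lambda>A. A \<in> sets M \<and> L2_approx_continuous M (indicator A :: 'a \<Rightarrow> complex)"], goal_cases int_stable sub basic empty compl union)
    case int_stable
    show ?case by (auto simp: Int_stable_def)
  next
    case sub
    show ?case by simp
  next
    case (basic A)
    thus ?case using L2_approx_continuous_closed by (simp add: sets_borel)
  next
    case empty
    show ?case using L2_approx_continuous_closed[of "{}"] by simp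
  next
    case (compl A)
    have "L2_approx_continuous M (\<lambda>x. indicator UNIV x + (-1) * indicator A x)"
      by (rule L2_approx_continuous_add[OF L2_approx_continuous_closed[OF closed_UNIV] L2_approx_continuous_scale])
         (use compl in blast)
    moreover have "(\<lambda>x. indicator UNIV x + (-1) * indicator A x) = (indicator (UNIV - A) :: 'a \<Rightarrow> complex)"
      by (auto simp: indicator_def)
    moreover have "UNIV - A \<in> sets M"
      using compl sets.compl_sets[of A M] by simp
    ultimately show ?case by simp
  next
    case (union A)
    have meas: "(\<Union>i. A i) \<in> sets M" using union by auto
    have lim: "(\<lambda>n. indicator (\<Union>i<n. A i) x :: complex) \<longlonglongrightarrow> indicator (\<Union>i. A i) x" for x
      by (rule LIMSEQ_indicator_UN)
    have eq: "(indicator (\<Union>i<n. A i) :: 'a \<Rightarrow> complex) = (\<lambda>x. \<Sum>i<n. indicator (A i) x)" for n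
      using union(1) by (intro ext indicator_UN_disjoint) (auto simp: disjoint_family_on_def)
    have ap: "L2_approx_continuous M (indicator (\<Union>i<n. A i) :: 'a \<Rightarrow> complex)" for n
      unfolding eq using union by (intro L2_approx_continuous_sum) auto
    have "(indicator (\<Union>i. A i) :: 'a \<Rightarrow> complex) \<in> borel_measurable M"
      using meas by (rule borel_measurable_indicator)
    note dom = L2_dominated[OF this _ L2_const[of 1], of "\<lambda>n. indicator (\<Union>i<n. A i)", OF _ _ lim]
    have L2: "(indicator (\<Union>i<n. A i) :: 'a \<Rightarrow> complex) \<in> L2 M" for n
      using ap L2_approx_continuous_def by blast
    have "L2_approx_continuous M (indicator (\<Union>i. A i) :: 'a \<Rightarrow> complex)"
      by (rule L2_approx_continuous_lim[OF dom(1) ap dom(2)]) (use L2 in \<open>auto simp: indicator_def\<close>)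
    with meas show ?case by simp
  qed
  thus ?thesis by simp
qed

proposition continuous_dense_L2:
  assumes "h \<in> L2 M"
  shows "L2_approx_continuous M h"
proof -
  obtain s where s: "\<And>i. simple_function M (s i)" "\<And>x. (\<lambda>i. s i x) \<longlonglongrightarrow> h x"
    "\<And>i x. dist (s i x) 0 \<le> 2 * dist (h x) 0"
    using borel_measurable_implies_sequence_metric[OF L2_measurable[OF assms], of 0] by auto
  have ap: "L2_approx_continuous M (s i)" for i
  proof -
    have eq: "s i = (\<lambda>x. \<Sum>y\<in>range (s i). y * indicator (s i -` {y}) x)"
    proof
      fix x
      have fin: "finite (range (s i))" using simple_functionD(1)[OF s(1)[of i]] by simp
      have "(\<Sum>y\<in>range (s i). y * indicator (s i -` {y}) x) = (\<Sum>y\<in>range (s i). if y = s i x then y else 0)"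
        by (intro sum.cong) (auto simp: indicator_def)
      thus "s i x = (\<Sum>y\<in>range (s i). y * indicator (s i -` {y}) x)" using fin by simp
    qed
    have "s i -` {y} \<in> sets M" for y
      using simple_functionD(2)[OF s(1), of i "{y}"] by simp
    thus ?thesis
      by (subst eq) (intro L2_approx_continuous_sum L2_approx_continuous_scale L2_approx_continuous_indicator)
  qed
  have sL2: "s i \<in> L2 M" for i using ap L2_approx_continuous_def by blast
  have w: "cmod (s i x) \<le> cmod (2 * h x)" for i x using s(3)[of i x] by (simp add: norm_mult)
  note dom = L2_dominated[OF L2_measurable[OF assms] sL2 L2_scale[OF assms, of 2] w s(2)]
  show ?thesis by (rule L2_approx_continuous_lim[OF assms ap dom(2)])
qed

end

section \<open>The pointwise ergodic theorem\<close>

locale invariant_borel_system = borel_prob_space M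
  for M :: "'a::metric_space measure" +
  fixes T :: "'a \<Rightarrow> 'a"
  assumes continuous_T: "continuous_on UNIV T"
    and distr_T: "distr M borel T = M"
begin

lemma prob_UNIV: "prob UNIV = 1"
  using prob_space by simp

lemma measurable_T [measurable]: "T \<in> measurable M M"
proof -
  have "T \<in> borel_measurable borel" using continuous_T by (rule borel_measurable_continuous_onI)
  thus ?thesis using sets_borel measurable_cong_sets by blast
qed

lemma distr_T_self: "distr M M T = M"
  using distr_T distr_cong[of M M M borel T T] sets_borel by simp

lemma AE_T: "AE x in M. P x \<Longrightarrow> AE x in M. P (T x)"
  using AE_distrD[OF measurable_T, of P] unfolding distr_T_self .

text \<open>
  Invariance makes every preimage of a null set null, so a property that holds almost everywhere holds on
  almost every whole orbit.
\<close>

lemma AE_orbit: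
  assumes "AE x in M. P x"
  shows "AE x in M. \<forall>j. P ((T ^^ j) x)"
proof -
  have "AE x in M. P ((T ^^ j) x)" for j
  proof (induction j)
    case (Suc j)
    from AE_T[OF this] show ?case by (simp add: funpow_swap1)
  qed (use assms in simp)
  thus ?thesis by (simp add: AE_all_countable)
qed

lemma integral_T:
  fixes f :: "'a \<Rightarrow> 'b::{banach, second_countable_topology}"
  assumes "f \<in> borel_measurable M"
  shows "(\<integral>x. f (T x) \<partial>M) = (\<integral>x. f x \<partial>M)"
  using integral_distr[OF measurable_T assms] by (simp add: distr_T_self)

lemma integrable_T:
  fixes f :: "'a \<Rightarrow> 'b::{banach, second_countable_topology}"
  assumes "integrable M f"
  shows "integrable M (\<lambda>x. f (T x))"
  using assms integrable_distr[OF measurable_T, of f] by (simp add: distr_T_self)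

end

definition birkhoff_sum :: "('a \<Rightarrow> 'a) \<Rightarrow> ('a \<Rightarrow> real) \<Rightarrow> nat \<Rightarrow> 'a \<Rightarrow> real" where
  "birkhoff_sum T f n x = (\<Sum>j<n. f ((T ^^ j) x))"

text \<open>
  The maximum of the Birkhoff sums over \<open>1, \<dots>, n + 1\<close> terms. The recursion through \<open>T x\<close> yields at once the
  identity \<open>m (Suc n) x - m n (T x) = f x + max 0 (- m n (T x))\<close> on which the ergodic theorem rests.
\<close>

primrec max_birkhoff_sum :: "('a \<Rightarrow> 'a) \<Rightarrow> ('a \<Rightarrow> real) \<Rightarrow> nat \<Rightarrow> 'a \<Rightarrow> real" where
  "max_birkhoff_sum T f 0 x = f x"
| "max_birkhoff_sum T f (Suc n) x = f x + max 0 (max_birkhoff_sum T f n (T x))"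

lemma birkhoff_sum_Suc: "birkhoff_sum T f (Suc n) x = f x + birkhoff_sum T f n (T x)"
  unfolding birkhoff_sum_def sum.lessThan_Suc_shift by (simp add: funpow_swap1)

lemma birkhoff_sum_le_max: "birkhoff_sum T f (Suc n) x \<le> max_birkhoff_sum T f n x"
proof (induction n arbitrary: x)
  case 0
  show ?case by (simp add: birkhoff_sum_def)
next
  case (Suc n)
  show ?case using Suc[of "T x"] by (simp add: birkhoff_sum_Suc[of T f "Suc n"])
qed

lemma max_birkhoff_sum_mono_Suc: "max_birkhoff_sum T f n x \<le> max_birkhoff_sum T f (Suc n) x"
proof (induction n arbitrary: x)
  case (Suc n)
  show ?case using Suc[of "T x"] by simp
qed simp

lemma max_birkhoff_sum_mono: "m \<le> n \<Longrightarrow> max_birkhoff_sum T f m x \<le> max_birkhoff_sum T f n x"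
  by (rule lift_Suc_mono_le[of "\<lambda>n. max_birkhoff_sum T f n x"]) (rule max_birkhoff_sum_mono_Suc)

lemma max_birkhoff_sum_unbounded_iff:
  "(\<forall>c::nat. \<exists>n. real c < max_birkhoff_sum T f n (T x)) \<longleftrightarrow> (\<forall>c::nat. \<exists>n. real c < max_birkhoff_sum T f n x)"
  (is "?L \<longleftrightarrow> ?R")
proof
  assume L: ?L
  show ?R
  proof
    fix c :: nat
    obtain d :: nat where d: "real c - f x \<le> d" using real_arch_simple by blast
    obtain n where "real d < max_birkhoff_sum T f n (T x)" using L by blast
    with d have "real c < max_birkhoff_sum T f (Suc n) x" by simp
    thus "\<exists>n. real c < max_birkhoff_sum T f n x" by blast
  qed
next
  assume R: ?R
  show ?L
  proof
    fix c :: nat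
    obtain d :: nat where d: "f x + real c \<le> d" using real_arch_simple by blast
    obtain n where n: "real d < max_birkhoff_sum T f n x" using R by blast
    then obtain m where "n = Suc m" using d by (cases n) auto
    with n d have "real c < max_birkhoff_sum T f m (T x)" by (auto simp: max_def split: if_splits)
    thus "\<exists>n. real c < max_birkhoff_sum T f n (T x)" by blast
  qed
qed

locale ergodic_borel_system = invariant_borel_system +
  assumes ergodic: "ergodic_measure T M"
begin

text \<open>
  Let \<open>m n\<close> denote the maximal sums and suppose that they are unbounded on a set of positive measure. This
  set is invariant, hence has full measure, and then \<open>max 0 (- m n (T x))\<close> tends to \<open>0\<close> almost
  everywhere, dominated by \<open>|f (T x)|\<close>. As \<open>m n\<close> is increasing in \<open>n\<close> and \<open>T\<close> preserves the measure,
  \<open>m (Suc n) - m n \<circ> T\<close> has nonnegative integral; these integrals converge to \<open>\<integral>f\<close>, which was negative.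
\<close>

lemma birkhoff_sums_bounded_above:
  fixes f :: "'a \<Rightarrow> real"
  assumes f: "integrable M f" and neg: "(\<integral>x. f x \<partial>M) < 0"
  shows "AE x in M. \<exists>c. \<forall>n. birkhoff_sum T f n x \<le> c"
proof -
  let ?m = "max_birkhoff_sum T f"
  have int: "integrable M (?m n)" for n
  proof (induction n)
    case 0
    show ?case using f by (simp add: max_birkhoff_sum.simps(1)[abs_def])
  next
    case (Suc n)
    have "integrable M (\<lambda>x. f x + max 0 (?m n (T x)))"
      by (intro Bochner_Integration.integrable_add f integrable_max integrable_T[OF Suc]) simp
    thus ?case by (simp add: max_birkhoff_sum.simps(2)[abs_def])
  qed
  have [measurable]: "?m n \<in> borel_measurable M" for n using int by auto
  define A where "A = {x. \<forall>c::nat. \<exists>n. real c < ?m n x}"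
  have "{x\<in>space M. \<forall>c::nat. \<exists>n. real c < ?m n x} \<in> sets M" by measurable
  hence A: "A \<in> sets M" by (simp add: A_def)
  have "T -` A = A" unfolding A_def using max_birkhoff_sum_unbounded_iff[of T f] by auto
  hence "prob A = 0 \<or> prob A = 1" using ergodic A unfolding ergodic_measure_def by blast
  moreover have "prob A \<noteq> 1"
  proof
    assume "prob A = 1"
    hence "AE x in M. x \<in> A" using prob_eq_1[OF A] by simp
    hence AT: "AE x in M. T x \<in> A" by (rule AE_T)
    define d where "d n x = max 0 (- ?m n (T x))" for n x
    have "(\<lambda>n. \<integral>x. d n x \<partial>M) \<longlonglongrightarrow> (\<integral>x. 0 \<partial>M)"
    proof (rule integral_dominated_convergence)
      show "integrable M (\<lambda>x. \<bar>f (T x)\<bar>)" using integrable_T[OF f] by simp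
      show "d n \<in> borel_measurable M" for n unfolding d_def by measurable
      show "AE x in M. norm (d n x) \<le> \<bar>f (T x)\<bar>" for n
      proof (rule AE_I2)
        fix x
        show "norm (d n x) \<le> \<bar>f (T x)\<bar>"
          using max_birkhoff_sum_mono[of 0 n T f "T x"] by (auto simp: d_def max_def abs_if)
      qed
      show "AE x in M. (\<lambda>n. d n x) \<longlonglongrightarrow> 0"
        using AT
      proof eventually_elim
        case (elim x)
        hence "\<exists>N. real 0 < ?m N (T x)" unfolding A_def by blast
        then obtain N where N: "0 < ?m N (T x)" by auto
        have "\<forall>\<^sub>F n in sequentially. d n x = 0"
          using eventually_ge_at_top[of N]
        proof eventually_elim
          case (elim n)
          thus ?case using N max_birkhoff_sum_mono[of N n T f "T x"] by (simp add: d_def)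
        qed
        thus ?case by (rule tendsto_eventually)
      qed
    qed simp
    moreover have "- (\<integral>x. f x \<partial>M) \<le> (\<integral>x. d n x \<partial>M)" for n
    proof -
      have eq: "d n x = ?m (Suc n) x - f x - ?m n (T x)" for x by (simp add: d_def max_def)
      have "(\<integral>x. d n x \<partial>M) = (\<integral>x. ?m (Suc n) x \<partial>M) - (\<integral>x. f x \<partial>M) - (\<integral>x. ?m n (T x) \<partial>M)"
        unfolding eq using int f integrable_T[OF int]
        by (subst Bochner_Integration.integral_diff, (intro Bochner_Integration.integrable_diff; simp del: max_birkhoff_sum.simps), simp)+
           (simp del: max_birkhoff_sum.simps)
      moreover have "(\<integral>x. ?m n (T x) \<partial>M) = (\<integral>x. ?m n x \<partial>M)" by (rule integral_T) simp
      moreover have "(\<integral>x. ?m n x \<partial>M) \<le> (\<integral>x. ?m (Suc n) x \<partial>M)"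
        by (rule integral_mono[OF int int max_birkhoff_sum_mono_Suc])
      ultimately show ?thesis by linarith
    qed
    ultimately have "- (\<integral>x. f x \<partial>M) \<le> 0"
      by (intro tendsto_lowerbound[of "\<lambda>n. \<integral>x. d n x \<partial>M" 0 sequentially]) auto
    thus False using neg by simp
  qed
  ultimately have "AE x in M. x \<notin> A" using prob_eq_0[OF A] by simp
  thus ?thesis
  proof eventually_elim
    case (elim x)
    then obtain c :: nat where c: "\<And>n. ?m n x \<le> real c" unfolding A_def by (auto simp: not_less)
    have "birkhoff_sum T f n x \<le> real c" for n
    proof (cases n)
      case 0
      thus ?thesis by (simp add: birkhoff_sum_def)
    next
      case (Suc k)
      thus ?thesis using birkhoff_sum_le_max[of T f k x] c[of k] by simp
    qed
    thus ?case by blast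
  qed
qed

text \<open>
  The previous lemma applies to \<open>f - (\<integral>f + \<epsilon>)\<close>, whose integral is negative; bounded sums divided by \<open>n\<close>
  vanish in the limit.
\<close>

lemma birkhoff_average_upper:
  fixes f :: "'a \<Rightarrow> real"
  assumes f: "integrable M f"
  shows "AE x in M. \<forall>k::nat. \<forall>\<^sub>F n in sequentially.
           birkhoff_sum T f n x / n < (\<integral>y. f y \<partial>M) + 2 / real (Suc k)"
  unfolding AE_all_countable
proof
  fix k :: nat
  define e where "e = 1 / real (Suc k)"
  have e: "0 < e" by (simp add: e_def)
  define a where "a = (\<integral>y. f y \<partial>M) + e"
  have "integrable M (\<lambda>x. f x - a)" using f by simp
  moreover have "(\<integral>x. f x - a \<partial>M) < 0" using f e by (simp add: a_def prob_UNIV)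
  ultimately have "AE x in M. \<exists>c. \<forall>n. birkhoff_sum T (\<lambda>x. f x - a) n x \<le> c"
    by (rule birkhoff_sums_bounded_above)
  thus "AE x in M. \<forall>\<^sub>F n in sequentially. birkhoff_sum T f n x / n < (\<integral>y. f y \<partial>M) + 2 / real (Suc k)"
  proof eventually_elim
    case (elim x)
    then obtain c where c: "\<And>n. birkhoff_sum T (\<lambda>x. f x - a) n x \<le> c" by blast
    have "(\<lambda>n. c * (1 / real n)) \<longlonglongrightarrow> c * 0" by (intro tendsto_intros lim_1_over_n)
    hence "\<forall>\<^sub>F n in sequentially. c * (1 / real n) < e" using e by (intro order_tendstoD) auto
    thus ?case using eventually_gt_at_top[of 0]
    proof eventually_elim
      case (elim n)
      have "birkhoff_sum T f n x - real n * a \<le> c"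
        using c[of n] by (simp add: birkhoff_sum_def sum_subtractf)
      hence "birkhoff_sum T f n x / n \<le> a + c * (1 / real n)"
        using elim by (simp add: field_simps)
      thus ?case using elim by (simp add: a_def e_def)
    qed
  qed
qed

theorem birkhoff_real:
  fixes f :: "'a \<Rightarrow> real"
  assumes f: "integrable M f"
  shows "AE x in M. (\<lambda>n. (\<Sum>j<n. f ((T ^^ j) x)) / n) \<longlonglongrightarrow> (\<integral>y. f y \<partial>M)"
proof -
  have "integrable M (\<lambda>x. - f x)" using f by simp
  from birkhoff_average_upper[OF this] birkhoff_average_upper[OF f] show ?thesis
  proof eventually_elim
    case (elim x)
    show ?case
    proof (rule LIMSEQ_I)
      fix r :: real assume r: "0 < r"
      obtain k where "inverse (real (Suc k)) < r / 2" using reals_Archimedean[of "r/2"] r by auto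
      hence k: "2 / real (Suc k) < r" by (simp add: inverse_eq_divide del: of_nat_Suc)
      have "\<forall>\<^sub>F n in sequentially. norm (birkhoff_sum T f n x / n - (\<integral>y. f y \<partial>M)) < r"
        using elim[rule_format, of k]
      proof eventually_elim
        case (elim n)
        have "birkhoff_sum T (\<lambda>x. - f x) n x = - birkhoff_sum T f n x"
          by (simp add: birkhoff_sum_def sum_negf)
        with elim(1) have "- (birkhoff_sum T f n x / n) < - (\<integral>y. f y \<partial>M) + 2 / real (Suc k)" by simp
        with elim(2) k show ?case unfolding real_norm_def abs_less_iff by linarith
      qed
      thus "\<exists>no. \<forall>n\<ge>no. norm ((\<Sum>j<n. f ((T ^^ j) x)) / n - (\<integral>y. f y \<partial>M)) < r"
        by (simp add: birkhoff_sum_def eventually_sequentially)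
    qed
  qed
qed

corollary birkhoff_complex:
  fixes f :: "'a \<Rightarrow> complex"
  assumes f: "integrable M f"
  shows "AE x in M. (\<lambda>n. (\<Sum>j<n. f ((T ^^ j) x)) / of_nat n) \<longlonglongrightarrow> (\<integral>y. f y \<partial>M)"
proof -
  have "integrable M (\<lambda>x. Re (f x))" "integrable M (\<lambda>x. Im (f x))" using f by auto
  from this[THEN birkhoff_real] show ?thesis
  proof eventually_elim
    case (elim x)
    thus ?case using f
      unfolding tendsto_complex_iff by simp
  qed
qed

end

section \<open>Separability of the space of continuous functions\<close>

text \<open>
  For each pair of tolerances \<open>1 / Suc n\<close> in the argument and \<open>1 / Suc m\<close> in the value there are
  countably many assignments \<open>v\<close> of values from a countable dense set to the points of a finite net. Picking one
  function that follows each assignment, whenever there is one, gives a dense set: by uniform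
  continuity every \<open>f\<close> follows some assignment, and two functions that follow the same one are uniformly close.
\<close>

lemma countable_dense_bcontfun:
  assumes "compact (UNIV :: 'a::metric_space set)"
  shows "\<exists>D :: ('a \<Rightarrow>\<^sub>C complex) set. countable D \<and> closure D = UNIV"
proof -
  obtain Q :: "complex set" where Q: "countable Q" "\<And>X. open X \<Longrightarrow> X \<noteq> {} \<Longrightarrow> \<exists>d\<in>Q. d \<in> X"
    by (erule countable_dense_setE)
  have "\<forall>n::nat. \<exists>k. finite k \<and> (UNIV::'a set) \<subseteq> (\<Union>p\<in>k. ball p (1 / real (Suc n)))"
    using assms unfolding compact_eq_totally_bounded by auto
  then obtain K where K: "\<And>n::nat. finite (K n)" "\<And>n. (UNIV::'a set) \<subseteq> (\<Union>p\<in>K n. ball p (1 / real (Suc n)))"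
    by metis
  define near where "near n m v = {f :: 'a \<Rightarrow>\<^sub>C complex.
      \<forall>p\<in>K n. \<forall>y\<in>ball p (1 / real (Suc n)). dist (f y) (v p) < 1 / real (Suc m)}" for n m :: nat and v
  define pick where "pick = (\<lambda>(n, m, v). SOME f. f \<in> near n m v)"
  define D where "D = pick ` (SIGMA n:UNIV. UNIV \<times> PiE (K n) (\<lambda>_. Q))"
  have "countable D"
    unfolding D_def using K(1) Q(1) by (intro countable_image countable_SIGMA countable_PiE) auto
  moreover have "f \<in> closure D" for f :: "'a \<Rightarrow>\<^sub>C complex"
    unfolding closure_approachable
  proof safe
    fix e :: real assume e: "0 < e"
    obtain m where "inverse (real (Suc m)) < e / 2" using reals_Archimedean[of "e/2"] e by auto
    define r where "r = 1 / real (Suc m)"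
    have r: "0 < r" "2 * r < e" using \<open>inverse _ < _\<close> by (auto simp: r_def inverse_eq_divide simp del: of_nat_Suc)
    have "uniformly_continuous_on UNIV (apply_bcontfun f)"
      using assms by (intro compact_uniformly_continuous) auto
    then obtain d where d: "0 < d" "\<And>x y. dist x y < d \<Longrightarrow> dist (f x) (f y) < r / 2"
      unfolding uniformly_continuous_on_def using r by (meson UNIV_I half_gt_zero)
    obtain n where "inverse (real (Suc n)) < d" using reals_Archimedean[OF d(1)] by auto
    hence n: "1 / real (Suc n) < d" by (simp add: inverse_eq_divide)
    have "\<forall>p. \<exists>q\<in>Q. dist (f p) q < r / 2"
    proof
      fix p
      have "ball (f p) (r / 2) \<noteq> {}" using r by simp
      from Q(2)[OF open_ball this] show "\<exists>q\<in>Q. dist (f p) q < r / 2" by auto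
    qed
    then obtain q where q: "\<And>p. q p \<in> Q" "\<And>p. dist (f p) (q p) < r / 2" by metis
    define v where "v = restrict q (K n)"
    have f: "f \<in> near n m v"
      unfolding near_def
    proof (safe)
      fix p y assume p: "p \<in> K n" and "y \<in> ball p (1 / real (Suc n))"
      hence "dist y p < d" using n by (simp add: dist_commute)
      hence "dist (f y) (f p) < r / 2" by (rule d(2))
      with q(2)[of p] have "dist (f y) (q p) < r" using dist_triangle[of "f y" "q p" "f p"] by simp
      thus "dist (f y) (v p) < 1 / real (Suc m)" using p by (simp add: v_def r_def)
    qed
    define g where "g = pick (n, m, v)"
    have g: "g \<in> near n m v" unfolding g_def pick_def using someI[of "\<lambda>f. f \<in> near n m v", OF f] by simp
    have "v \<in> PiE (K n) (\<lambda>_. Q)" using q(1) by (simp add: v_def)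
    hence "g \<in> D" unfolding D_def g_def by (intro imageI) auto
    moreover have "dist g f \<le> 2 * r"
    proof (rule dist_bound)
      fix y
      obtain p where p: "p \<in> K n" "y \<in> ball p (1 / real (Suc n))" using K(2)[of n] by blast
      have "dist (f y) (v p) < r" "dist (g y) (v p) < r"
        using f g p unfolding near_def r_def by auto
      thus "dist (g y) (f y) \<le> 2 * r" using dist_triangle2[of "g y" "f y" "v p"] by simp
    qed
    ultimately show "\<exists>y\<in>D. dist y f < e" using r by (meson le_less_trans)
  qed
  ultimately show ?thesis by blast
qed

section \<open>Orbits of generic points\<close>

lemma FB_avg_eq_bohr_avg: "FB_avg T f \<xi> n x = bohr_avg \<xi> n (\<lambda>j. f ((T ^^ j) x))"
  by (simp add: FB_avg_def bohr_avg_def)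

lemma dense_bcontfun_near:
  fixes f :: "'a::metric_space \<Rightarrow>\<^sub>C complex"
  assumes "closure D = UNIV" "0 < e"
  obtains g :: "'a \<Rightarrow>\<^sub>C complex" where "g \<in> D" "\<And>y. cmod (f y - g y) \<le> e"
proof -
  have "f \<in> closure D" using assms by simp
  then obtain g where g: "g \<in> D" "dist g f < e" using assms(2) unfolding closure_approachable by blast
  have "dist (f y) (g y) \<le> e" for y
    using dist_bounded[of f y g] g(2) by (simp add: dist_commute)
  hence "cmod (f y - g y) \<le> e" for y
    by (simp add: dist_norm)
  with g show ?thesis using that by blast
qed

locale compact_borel_system = invariant_borel_system +
  assumes compact_UNIV: "compact (UNIV :: 'a set)"
begin

lemma continuous_bcontfun:
  fixes h :: "'a \<Rightarrow> 'b::metric_space"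
  assumes "continuous_on UNIV h"
  obtains f where "h = apply_bcontfun f"
proof -
  have "bounded (range h)"
    using compact_continuous_image[OF assms compact_UNIV] by (rule compact_imp_bounded)
  hence "h \<in> bcontfun" using assms by (simp add: bcontfun_def)
  thus ?thesis using that by (rule bcontfunE)
qed

lemma continuous_L2: "continuous_on UNIV h \<Longrightarrow> (h :: 'a \<Rightarrow> complex) \<in> L2 M"
  by (erule continuous_bcontfun) simp

lemma continuous_funpow: "continuous_on UNIV (T ^^ j)"
proof (induction j)
  case (Suc j)
  thus ?case using continuous_on_compose[of UNIV "T ^^ j" T] continuous_T continuous_on_subset
    by (auto simp: o_def)
qed (simp add: id_def)

lemma generic_point_avg:
  fixes h :: "'a \<Rightarrow> complex"
  assumes "generic_point T M x" "continuous_on UNIV h"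
  shows "(\<lambda>n. (\<Sum>j<n. h ((T ^^ j) x)) / of_nat n) \<longlonglongrightarrow> (\<integral>y. h y \<partial>M)"
proof -
  obtain f where "h = apply_bcontfun f" using continuous_bcontfun[OF assms(2)] .
  thus ?thesis using assms(1) unfolding generic_point_def by blast
qed

lemma generic_point_rms:
  fixes h :: "'a \<Rightarrow> complex"
  assumes "generic_point T M x" "continuous_on UNIV h"
  shows "(\<lambda>n. (rms n (\<lambda>k. h ((T ^^ k) x)))\<^sup>2) \<longlonglongrightarrow> (L2_norm M h)\<^sup>2"
proof -
  have "continuous_on UNIV (\<lambda>y. complex_of_real ((cmod (h y))\<^sup>2))"
    by (intro continuous_intros assms)
  from tendsto_Re[OF generic_point_avg[OF assms(1) this]] show ?thesis
    by (simp only: integral_complex_of_real rms_power2 L2_norm_power2 Re_divide_of_nat Re_sum Re_complex_of_real)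
qed

text \<open>
  The transfer principle: an estimate along one generic orbit is an estimate in \<open>L\<^sup>2\<close>.
\<close>

lemma generic_point_L2_le:
  fixes h :: "'a \<Rightarrow> complex"
  assumes "generic_point T M x" "continuous_on UNIV h" "asymp_rms_le (\<lambda>k. h ((T ^^ k) x)) c"
  shows "L2_norm M h \<le> c"
proof -
  have "(\<lambda>n. sqrt ((rms n (\<lambda>k. h ((T ^^ k) x)))\<^sup>2)) \<longlonglongrightarrow> sqrt ((L2_norm M h)\<^sup>2)"
    by (intro tendsto_real_sqrt generic_point_rms assms)
  thus ?thesis using assms(3) by (intro asymp_rms_le_limit) auto
qed

definition almost_periodic_point :: "complex set \<Rightarrow> 'a \<Rightarrow> bool" where
  "almost_periodic_point S x \<longleftrightarrow> generic_point T M x \<and>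
     (\<forall>f :: 'a \<Rightarrow>\<^sub>C complex. almost_periodic S (\<lambda>k. f ((T ^^ k) x)))"

lemma almost_periodic_dense:
  fixes f :: "'a \<Rightarrow>\<^sub>C complex"
  assumes "closure D = (UNIV :: ('a \<Rightarrow>\<^sub>C complex) set)" "\<And>g. g \<in> D \<Longrightarrow> almost_periodic S (\<lambda>k. g ((T ^^ k) x))"
  shows "almost_periodic S (\<lambda>k. f ((T ^^ k) x))"
proof (rule almost_periodic_closed)
  fix e :: real assume e: "e > 0"
  obtain g where g: "g \<in> D" "\<And>y. cmod (f y - g y) \<le> e"
    using dense_bcontfun_near[OF assms(1) e] by blast
  have "asymp_rms_le (\<lambda>k. f ((T ^^ k) x) - g ((T ^^ k) x)) e"
    using g(2) e by (intro asymp_rms_le_bound) auto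
  with assms(2)[OF g(1)] show "\<exists>v. almost_periodic S v \<and> asymp_rms_le (\<lambda>k. f ((T ^^ k) x) - v k) e"
    by (intro exI[of _ "\<lambda>k. g ((T ^^ k) x)"]) simp
qed

lemma generic_point_dense:
  assumes D: "closure D = (UNIV :: ('a \<Rightarrow>\<^sub>C complex) set)"
    and lim: "\<And>g. g \<in> D \<Longrightarrow> (\<lambda>n. (\<Sum>j<n. g ((T ^^ j) x)) / of_nat n) \<longlonglongrightarrow> (\<integral>y. g y \<partial>M)"
  shows "generic_point T M x"
  unfolding generic_point_def
proof
  fix f :: "'a \<Rightarrow>\<^sub>C complex"
  show "(\<lambda>n. (\<Sum>j<n. f ((T ^^ j) x)) / of_nat n) \<longlonglongrightarrow> (\<integral>y. f y \<partial>M)"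
  proof (rule tendstoI)
    fix e :: real assume e: "0 < e"
    obtain g where g: "g \<in> D" "\<And>y. cmod (f y - g y) \<le> e / 4"
      using dense_bcontfun_near[OF D, of "e/4"] e by auto
    have "\<forall>\<^sub>F n in sequentially. dist ((\<Sum>j<n. g ((T ^^ j) x)) / of_nat n) (\<integral>y. g y \<partial>M) < e / 4"
      using lim[OF g(1)] e by (intro tendstoD) auto
    thus "\<forall>\<^sub>F n in sequentially. dist ((\<Sum>j<n. f ((T ^^ j) x)) / of_nat n) (\<integral>y. f y \<partial>M) < e"
    proof eventually_elim
      case (elim n)
      have "cmod ((\<Sum>j<n. 1 * (f ((T ^^ j) x) - g ((T ^^ j) x))) / of_nat n)
          \<le> rms n (\<lambda>j. f ((T ^^ j) x) - g ((T ^^ j) x))"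
        by (rule weighted_mean_le_rms) simp
      also have "\<dots> \<le> e / 4" using g(2) e by (intro rms_le_bound) auto
      finally have 1: "cmod ((\<Sum>j<n. f ((T ^^ j) x)) / of_nat n - (\<Sum>j<n. g ((T ^^ j) x)) / of_nat n) \<le> e / 4"
        by (simp add: sum_subtractf diff_divide_distrib)
      have "(\<integral>y. f y \<partial>M) - (\<integral>y. g y \<partial>M) = (\<integral>y. f y - g y \<partial>M)"
        by (intro Bochner_Integration.integral_diff[symmetric] L2_imp_integrable bcontfun_L2)
      also have "cmod \<dots> \<le> (\<integral>y. cmod (f y - g y) \<partial>M)" by (rule integral_norm_bound)
      also have "\<dots> \<le> L2_norm M (\<lambda>y. f y - g y)" by (intro L1_le_L2_norm L2_diff bcontfun_L2)
      also have "\<dots> \<le> e / 4"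
        using g(2) by (intro L2_norm_le_bound borel_measurable_diff L2_measurable bcontfun_L2)
      finally have 2: "cmod ((\<integral>y. f y \<partial>M) - (\<integral>y. g y \<partial>M)) \<le> e / 4" .
      have 3: "cmod ((\<Sum>j<n. g ((T ^^ j) x)) / of_nat n - (\<integral>y. g y \<partial>M)) < e / 4"
        using elim by (simp add: dist_norm)
      have tri: "cmod (a - d) \<le> cmod (a - b) + cmod (b - c) + cmod (d - c)" for a b c d :: complex
        using norm_triangle_ineq[of "a - b" "b - c"] norm_triangle_ineq[of "a - c" "c - d"]
        by (simp add: norm_minus_commute[of d c])
      show ?case
        unfolding dist_norm using tri[of "(\<Sum>j<n. f ((T ^^ j) x)) / of_nat n" "\<integral>y. f y \<partial>M"
            "(\<Sum>j<n. g ((T ^^ j) x)) / of_nat n" "\<integral>y. g y \<partial>M"] 1 2 3 e by linarith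
    qed
  qed
qed

end

section \<open>From discrete spectrum to almost periodic orbits\<close>

locale ergodic_compact_system = compact_borel_system + ergodic_borel_system
begin

lemma AE_eigenfunction_orbit:
  assumes "koopman_eigenfunction T M \<xi> e"
  shows "AE x in M. \<forall>k. e ((T ^^ k) x) = \<xi> ^ k * e x"
proof -
  have "AE x in M. e (T x) = \<xi> * e x"
    using assms by (simp add: koopman_eigenfunction_def koopman_def)
  from AE_orbit[OF this] show ?thesis
  proof eventually_elim
    case (elim x)
    have "e ((T ^^ k) x) = \<xi> ^ k * e x" for k by (induction k) (use elim in auto)
    thus ?case by blast
  qed
qed

lemma AE_rms_L2_norm:
  assumes "g \<in> L2 M"
  shows "AE x in M. (\<lambda>n. rms n (\<lambda>k. g ((T ^^ k) x))) \<longlonglongrightarrow> L2_norm M g"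
  using birkhoff_real[OF L2_integrable_power2[OF assms]]
proof eventually_elim
  case (elim x)
  from tendsto_real_sqrt[OF this] show ?case by (simp add: rms_def L2_norm_def)
qed

text \<open>
  Along almost every orbit an eigenfunction \<open>e\<close> takes the values \<open>\<xi>\<^sup>k * e x\<close>, so a finite combination of
  eigenfunctions becomes a trigonometric polynomial in \<open>k\<close>. Birkhoff's theorem for \<open>|g|\<^sup>2\<close>
  identifies the seminorm of the remainder \<open>g\<close> with its \<open>L\<^sup>2\<close> norm.
\<close>

lemma AE_near_trig_poly:
  assumes f: "f \<in> kronecker_space T M" and S: "Spec T M \<subseteq> S" and \<epsilon>: "0 < \<epsilon>"
  shows "AE x in M. \<exists>F b. finite F \<and> F \<subseteq> S \<and> asymp_rms_le (\<lambda>k. f ((T ^^ k) x) - trig_poly F b k) \<epsilon>"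
proof -
  obtain E c where E: "finite E" "E \<subseteq> {f. \<exists>\<xi>. koopman_eigenfunction T M \<xi> f}"
    and lt: "L2_norm M (\<lambda>x. f x - (\<Sum>e\<in>E. c e * e x)) < \<epsilon>"
  proof -
    have "\<exists>E c. finite E \<and> E \<subseteq> {f. \<exists>\<xi>. koopman_eigenfunction T M \<xi> f} \<and>
        L2_norm M (\<lambda>x. f x - (\<Sum>e\<in>E. c e * e x)) < \<epsilon>"
      using f \<epsilon> unfolding kronecker_space_def L2_closed_span_def mem_Collect_eq by (elim conjE allE impE)
    thus ?thesis using that by (elim exE conjE)
  qed
  define g where "g x = f x - (\<Sum>e\<in>E. c e * e x)" for x
  from E(2) have "\<forall>e\<in>E. \<exists>\<xi>. koopman_eigenfunction T M \<xi> e" by (simp add: subset_eq)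
  from bchoice[OF this] obtain \<xi> where "\<forall>e\<in>E. koopman_eigenfunction T M (\<xi> e) e" ..
  hence \<xi>: "koopman_eigenfunction T M (\<xi> e) e" if "e \<in> E" for e using that by (rule bspec)
  have "f \<in> L2 M" using f by (simp add: kronecker_space_def L2_closed_span_def)
  moreover have "e \<in> L2 M" if "e \<in> E" for e
    using \<xi>[OF that] by (simp add: koopman_eigenfunction_def)
  ultimately have gL2: "g \<in> L2 M"
    unfolding g_def by (intro L2_diff L2_sum L2_scale) auto
  have "AE x in M. (\<lambda>n. rms n (\<lambda>k. g ((T ^^ k) x))) \<longlonglongrightarrow> L2_norm M g"
    by (rule AE_rms_L2_norm[OF gL2])
  moreover have "AE x in M. \<forall>e\<in>E. \<forall>k. e ((T ^^ k) x) = \<xi> e ^ k * e x"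
    unfolding AE_finite_all[OF E(1)]
  proof
    fix e assume "e \<in> E"
    thus "AE x in M. \<forall>k. e ((T ^^ k) x) = \<xi> e ^ k * e x" by (intro AE_eigenfunction_orbit \<xi>)
  qed
  ultimately show ?thesis
  proof eventually_elim
    case (elim x)
    note lim = elim(1) and eig = elim(2)
    \<comment> \<open>different \<open>e \<in> E\<close> may share an eigenvalue, so their coefficients are collected\<close>
    define b where "b \<eta> = (\<Sum>e\<in>{e\<in>E. \<xi> e = \<eta>}. c e * e x)" for \<eta>
    have "g ((T ^^ k) x) = f ((T ^^ k) x) - trig_poly (\<xi> ` E) b k" for k
    proof -
      have "(\<Sum>e\<in>E. c e * e ((T ^^ k) x)) = (\<Sum>e\<in>E. c e * e x * \<xi> e ^ k)"
        using eig by (intro sum.cong) auto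
      also have "\<dots> = (\<Sum>\<eta>\<in>\<xi> ` E. \<Sum>e\<in>{e\<in>E. \<xi> e = \<eta>}. c e * e x * \<xi> e ^ k)"
        by (rule sum.image_gen[OF E(1)])
      also have "\<dots> = trig_poly (\<xi> ` E) b k"
        unfolding trig_poly_def b_def sum_distrib_right by (intro sum.cong) auto
      finally show ?thesis by (simp add: g_def)
    qed
    hence eq: "(\<lambda>k. g ((T ^^ k) x)) = (\<lambda>k. f ((T ^^ k) x) - trig_poly (\<xi> ` E) b k)" by (rule ext)
    have "L2_norm M g \<le> \<epsilon>" unfolding g_def by (rule less_imp_le[OF lt])
    from limit_asymp_rms_le[OF lim this]
    have "asymp_rms_le (\<lambda>k. f ((T ^^ k) x) - trig_poly (\<xi> ` E) b k) \<epsilon>"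
      unfolding eq .
    moreover have "\<xi> ` E \<subseteq> S" using \<xi> S unfolding Spec_def by blast
    ultimately show ?case using E(1) by blast
  qed
qed

proposition AE_almost_periodic_point:
  assumes ds: "discrete_spectrum T M" and S: "Spec T M \<subseteq> S"
  shows "AE x in M. almost_periodic_point S x"
proof -
  obtain D :: "('a \<Rightarrow>\<^sub>C complex) set" where D: "countable D" "closure D = UNIV"
    using countable_dense_bcontfun[OF compact_UNIV] by blast
  have "AE x in M. almost_periodic S (\<lambda>k. f ((T ^^ k) x))" for f :: "'a \<Rightarrow>\<^sub>C complex"
  proof -
    have "apply_bcontfun f \<in> kronecker_space T M"
      using ds bcontfun_L2[of f] unfolding discrete_spectrum_def by simp
    hence "AE x in M. \<forall>m::nat. \<exists>F b. finite F \<and> F \<subseteq> S \<and>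
        asymp_rms_le (\<lambda>k. f ((T ^^ k) x) - trig_poly F b k) (1 / real (Suc m))"
      unfolding AE_all_countable by (intro allI AE_near_trig_poly[OF _ S]) auto
    thus ?thesis
    proof eventually_elim
      case (elim x)
      show ?case unfolding almost_periodic_def
      proof (intro allI impI)
        fix \<epsilon> :: real assume "0 < \<epsilon>"
        then obtain m where "inverse (real (Suc m)) < \<epsilon>" using reals_Archimedean by blast
        hence "1 / real (Suc m) \<le> \<epsilon>" by (simp add: inverse_eq_divide)
        with elim show "\<exists>F b. finite F \<and> F \<subseteq> S \<and> asymp_rms_le (\<lambda>k. f ((T ^^ k) x) - trig_poly F b k) \<epsilon>"
          using asymp_rms_le_mono by meson
      qed
    qed
  qed
  hence "AE x in M. \<forall>f\<in>D. almost_periodic S (\<lambda>k. f ((T ^^ k) x))"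
    using D(1) by (simp add: AE_ball_countable)
  moreover have "AE x in M. \<forall>f\<in>D. (\<lambda>n. (\<Sum>j<n. f ((T ^^ j) x)) / of_nat n) \<longlonglongrightarrow> (\<integral>y. f y \<partial>M)"
    using D(1) by (simp add: AE_ball_countable birkhoff_complex L2_imp_integrable)
  ultimately show ?thesis
  proof eventually_elim
    case (elim x)
    show ?case unfolding almost_periodic_point_def
      using generic_point_dense[OF D(2)] almost_periodic_dense[OF D(2)] elim by blast
  qed
qed

end

section \<open>From almost periodic orbits to eigenfunctions\<close>

context invariant_borel_system
begin

lemma L2_norm_T:
  assumes "g \<in> L2 M"
  shows "L2_norm M (\<lambda>x. g (T x)) = L2_norm M g"
proof -
  have [measurable]: "g \<in> borel_measurable M" by (rule L2_measurable[OF assms])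
  show ?thesis unfolding L2_norm_def
    using integral_T[of "\<lambda>x. (cmod (g x))\<^sup>2"] by simp
qed

lemma L2_T:
  assumes "g \<in> L2 M"
  shows "(\<lambda>x. g (T x)) \<in> L2 M"
  using integrable_T[OF L2_integrable_power2[OF assms]]
    measurable_compose[OF measurable_T L2_measurable[OF assms]]
  by (simp add: L2_def)

text \<open>
  Composing both functions with \<open>T\<close> leaves the inner product unchanged and multiplies it by \<open>\<eta> * cnj \<xi>\<close>,
  which differs from \<open>1\<close>.
\<close>

lemma eigenfunctions_orthogonal:
  assumes g: "g \<in> L2 M" "AE x in M. g (T x) = \<eta> * g x"
    and h: "h \<in> L2 M" "AE x in M. h (T x) = \<xi> * h x"
    and \<xi>: "cmod \<xi> = 1" and neq: "\<xi> \<noteq> \<eta>"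
  shows "L2_inner M g h = 0"
proof -
  have int: "integrable M (\<lambda>x. g x * cnj (h x))" by (rule L2_inner_integrable[OF g(1) h(1)])
  have "L2_inner M g h = (\<integral>x. g (T x) * cnj (h (T x)) \<partial>M)"
    unfolding L2_inner_def using integral_T[OF borel_measurable_integrable[OF int]] by simp
  also have "\<dots> = (\<integral>x. (\<eta> * cnj \<xi>) * (g x * cnj (h x)) \<partial>M)"
  proof (rule integral_cong_AE)
    show "AE x in M. g (T x) * cnj (h (T x)) = \<eta> * cnj \<xi> * (g x * cnj (h x))"
      using g(2) h(2) by eventually_elim simp
    show "(\<lambda>x. g (T x) * cnj (h (T x))) \<in> borel_measurable M"
      by (rule borel_measurable_integrable[OF integrable_T[OF int]])
    show "(\<lambda>x. \<eta> * cnj \<xi> * (g x * cnj (h x))) \<in> borel_measurable M"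
      by (rule borel_measurable_integrable[OF integrable_mult_right[OF int]])
  qed
  also have "\<dots> = \<eta> * cnj \<xi> * L2_inner M g h"
    unfolding L2_inner_def by (rule integral_mult_right_zero)
  finally have "(1 - \<eta> * cnj \<xi>) * L2_inner M g h = 0" by (simp add: left_diff_distrib)
  moreover have "\<eta> * cnj \<xi> \<noteq> 1"
  proof
    assume 1: "\<eta> * cnj \<xi> = 1"
    have "cnj \<xi> * \<xi> = 1" using complex_norm_square[of \<xi>] \<xi> by (simp add: mult.commute)
    hence "\<eta> = (\<eta> * cnj \<xi>) * \<xi>" by (simp add: mult.assoc)
    with 1 neq show False by simp
  qed
  ultimately show ?thesis by simp
qed

end

locale almost_periodic_system = compact_borel_system +
  fixes S :: "complex set" and x
  assumes S_unit: "S \<subseteq> sphere 0 1"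
    and ap_point: "almost_periodic_point S x"
begin

lemma generic_x: "generic_point T M x"
  and ap_x: "almost_periodic S (\<lambda>k. f ((T ^^ k) x))" for f :: "'a \<Rightarrow>\<^sub>C complex"
  using ap_point by (auto simp: almost_periodic_point_def)

lemma FB_avg_tendsto:
  assumes "cmod \<xi> = 1"
  shows "(\<lambda>n. FB_avg T f \<xi> n x) \<longlonglongrightarrow> FB_lim T f \<xi> x"
  unfolding FB_lim_def convergent_LIMSEQ_iff[symmetric] FB_avg_eq_bohr_avg
  by (rule almost_periodic_convergent[OF ap_x S_unit assms])

lemma FB_lim_outside:
  assumes "cmod \<xi> = 1" "\<xi> \<notin> S"
  shows "FB_lim T f \<xi> x = 0"
  using FB_avg_tendsto[OF assms(1), of f] unfolding FB_avg_eq_bohr_avg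
  by (rule almost_periodic_limit_zero[OF ap_x S_unit assms])

lemma continuous_FB_avg: "continuous_on UNIV (FB_avg T f \<xi> n)"
proof -
  have "continuous_on UNIV (\<lambda>y. f ((T ^^ j) y))" for j
    using continuous_on_compose2[OF continuous_on_apply_bcontfun[of UNIV f] continuous_funpow[of j]] by simp
  thus ?thesis unfolding FB_avg_def[abs_def] divide_inverse
    by (intro continuous_intros)
qed

lemma FB_avg_L2: "FB_avg T f \<xi> n \<in> L2 M"
  by (rule continuous_L2[OF continuous_FB_avg])

lemma FB_avg_orbit:
  assumes "cmod \<xi> = 1" "0 < e"
  shows "\<forall>\<^sub>F n in sequentially. asymp_rms_le (\<lambda>k. FB_avg T f \<xi> n ((T ^^ k) x) - FB_lim T f \<xi> x * \<xi> ^ k) e"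
proof -
  have eq: "FB_avg T f \<xi> n ((T ^^ k) x) = bohr_avg \<xi> n (\<lambda>j. f ((T ^^ (k + j)) x))" for n k
    by (simp add: FB_avg_eq_bohr_avg funpow_add add.commute[of k])
  show ?thesis unfolding eq
    using FB_avg_tendsto[OF assms(1), of f] unfolding FB_avg_eq_bohr_avg
    by (rule almost_periodic_shifted_avg[OF ap_x S_unit assms(1) _ assms(2)])
qed

text \<open>
  On the orbit of \<open>x\<close> the averages \<open>A\<^sub>n\<close> are all close to one sequence \<open>c * \<xi>\<^sup>k\<close>, hence close to each other;
  by genericity of \<open>x\<close> they are then close in \<open>L\<^sup>2\<close>.
\<close>

lemma FB_avg_L2_convergent:
  assumes \<xi>: "cmod \<xi> = 1"
  shows "\<exists>h\<in>L2 M. (\<lambda>n. L2_norm M (\<lambda>y. FB_avg T f \<xi> n y - h y)) \<longlonglongrightarrow> 0"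
proof (rule L2_complete[OF FB_avg_L2])
  fix e :: real assume e: "e > 0"
  have "\<forall>\<^sub>F n in sequentially. asymp_rms_le (\<lambda>k. FB_avg T f \<xi> n ((T ^^ k) x) - FB_lim T f \<xi> x * \<xi> ^ k) (e/3)"
    using e by (intro FB_avg_orbit \<xi>) simp
  then obtain N where N: "\<And>n. n \<ge> N \<Longrightarrow>
      asymp_rms_le (\<lambda>k. FB_avg T f \<xi> n ((T ^^ k) x) - FB_lim T f \<xi> x * \<xi> ^ k) (e/3)"
    unfolding eventually_sequentially by blast
  have "L2_norm M (\<lambda>y. FB_avg T f \<xi> m y - FB_avg T f \<xi> n y) < e" if "m \<ge> N" "n \<ge> N" for m n
  proof -
    have "asymp_rms_le (\<lambda>k. FB_avg T f \<xi> m ((T ^^ k) x) - FB_avg T f \<xi> n ((T ^^ k) x)) (e/3 + e/3)"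
      using asymp_rms_le_diff[OF N[OF that(1)] N[OF that(2)]] by simp
    hence "L2_norm M (\<lambda>y. FB_avg T f \<xi> m y - FB_avg T f \<xi> n y) \<le> e/3 + e/3"
      by (intro generic_point_L2_le[OF generic_x] continuous_on_diff continuous_FB_avg)
    thus ?thesis using e by simp
  qed
  thus "\<exists>N. \<forall>m\<ge>N. \<forall>n\<ge>N. L2_norm M (\<lambda>y. FB_avg T f \<xi> m y - FB_avg T f \<xi> n y) < e" by blast
qed

text \<open>
  This is the orthogonal projection of \<open>f\<close> onto the eigenspace of \<open>\<xi>\<close>, obtained as the mean ergodic limit of
  the operator \<open>\<xi>\<^sup>-\<^sup>1 U\<^sub>T\<close>. A representative is chosen; it vanishes almost everywhere when \<open>\<xi>\<close> does not
  occur in \<open>f\<close>.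
\<close>

definition eigencomponent :: "('a \<Rightarrow>\<^sub>C complex) \<Rightarrow> complex \<Rightarrow> 'a \<Rightarrow> complex" where
  "eigencomponent f \<xi> = (SOME h. h \<in> L2 M \<and> (\<lambda>n. L2_norm M (\<lambda>y. FB_avg T f \<xi> n y - h y)) \<longlonglongrightarrow> 0)"

lemma
  assumes "cmod \<xi> = 1"
  shows eigencomponent_L2: "eigencomponent f \<xi> \<in> L2 M"
    and eigencomponent_lim: "(\<lambda>n. L2_norm M (\<lambda>y. FB_avg T f \<xi> n y - eigencomponent f \<xi> y)) \<longlonglongrightarrow> 0"
proof -
  have "\<exists>h. h \<in> L2 M \<and> (\<lambda>n. L2_norm M (\<lambda>y. FB_avg T f \<xi> n y - h y)) \<longlonglongrightarrow> 0"
    using FB_avg_L2_convergent[OF assms, of f] by blast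
  from someI_ex[OF this]
  show "eigencomponent f \<xi> \<in> L2 M" "(\<lambda>n. L2_norm M (\<lambda>y. FB_avg T f \<xi> n y - eigencomponent f \<xi> y)) \<longlonglongrightarrow> 0"
    unfolding eigencomponent_def[symmetric] by (rule conjunct1, rule conjunct2)
qed

text \<open>
  Applying \<open>T\<close> shifts the averaging window by one, so after multiplication by \<open>\<xi>\<close> only the two end terms
  differ.
\<close>

lemma FB_avg_T:
  assumes "cmod \<xi> = 1"
  shows "cmod (FB_avg T f \<xi> n (T y) - \<xi> * FB_avg T f \<xi> n y) \<le> 2 * norm f * (1 / real n)"
proof (cases "n = 0")
  case False
  define a where "a j = \<xi> powi (- int j) * f ((T ^^ j) y)" for j
  have \<xi>0: "\<xi> \<noteq> 0" using assms by auto
  have step: "\<xi> powi (- int j) * f ((T ^^ j) (T y)) = \<xi> * a (Suc j)" for j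
  proof -
    have "\<xi> * \<xi> powi (- int (Suc j)) = \<xi> powi (1 + (- int (Suc j)))"
      using \<xi>0 by (subst power_int_add) auto
    thus ?thesis by (simp add: a_def funpow_swap1 flip: mult.assoc)
  qed
  have "(\<Sum>j<n. a (Suc j)) - (\<Sum>j<n. a j) = a n - a 0"
    by (simp add: sum_lessThan_telescope flip: sum_subtractf)
  hence "FB_avg T f \<xi> n (T y) - \<xi> * FB_avg T f \<xi> n y = \<xi> * (a n - a 0) / of_nat n"
    unfolding FB_avg_def step a_def[symmetric]
    by (simp add: diff_divide_distrib right_diff_distrib flip: sum_distrib_left)
       (metis diff_divide_distrib right_diff_distrib)
  moreover have "cmod (a n - a 0) \<le> 2 * norm f"
  proof -
    have "cmod (a j) \<le> norm f" for j
      by (simp add: a_def norm_mult cmod_unit_powi[OF assms] norm_bounded)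
    thus ?thesis using norm_triangle_ineq4[of "a n" "a 0"] by (smt (verit))
  qed
  ultimately show ?thesis by (simp add: norm_divide norm_mult assms divide_right_mono)
qed (simp add: FB_avg_def)

lemma eigencomponent_T:
  assumes \<xi>: "cmod \<xi> = 1"
  shows "AE y in M. eigencomponent f \<xi> (T y) = \<xi> * eigencomponent f \<xi> y"
proof -
  let ?h = "eigencomponent f \<xi>" and ?A = "FB_avg T f \<xi>"
  note h = eigencomponent_L2[OF \<xi>, of f]
  have le: "L2_norm M (\<lambda>y. ?h (T y) - \<xi> * ?h y) \<le> 2 * L2_norm M (\<lambda>y. ?A n y - ?h y) + 2 * norm f * (1 / real n)" for n
  proof -
    have "L2_norm M (\<lambda>y. ?h (T y) - \<xi> * ?h y)
        \<le> L2_norm M (\<lambda>y. ?h (T y) - ?A n (T y)) + L2_norm M (\<lambda>y. ?A n (T y) - \<xi> * ?h y)"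
      by (intro L2_triangle_diff L2_T L2_scale h FB_avg_L2)
    moreover have "L2_norm M (\<lambda>y. ?A n (T y) - \<xi> * ?h y)
        \<le> L2_norm M (\<lambda>y. ?A n (T y) - \<xi> * ?A n y) + L2_norm M (\<lambda>y. \<xi> * ?A n y - \<xi> * ?h y)"
      by (intro L2_triangle_diff L2_T L2_scale h FB_avg_L2)
    moreover have "L2_norm M (\<lambda>y. ?h (T y) - ?A n (T y)) = L2_norm M (\<lambda>y. ?A n y - ?h y)"
      using L2_norm_T[OF L2_diff[OF h FB_avg_L2[of f \<xi> n]]] L2_norm_minus_commute[of M ?h "?A n"] by simp
    moreover have "L2_norm M (\<lambda>y. \<xi> * ?A n y - \<xi> * ?h y) = L2_norm M (\<lambda>y. ?A n y - ?h y)"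
      using L2_norm_scale[of M \<xi> "\<lambda>y. ?A n y - ?h y"] \<xi> by (simp add: right_diff_distrib)
    moreover have "L2_norm M (\<lambda>y. ?A n (T y) - \<xi> * ?A n y) \<le> 2 * norm f * (1 / real n)"
      by (intro L2_norm_le_bound FB_avg_T[OF \<xi>] L2_measurable L2_diff L2_T L2_scale FB_avg_L2)
    ultimately show ?thesis by linarith
  qed
  have "(\<lambda>n. 2 * L2_norm M (\<lambda>y. ?A n y - ?h y) + 2 * norm f * (1 / real n)) \<longlonglongrightarrow> 2 * 0 + 2 * norm f * 0"
    by (intro tendsto_intros eigencomponent_lim \<xi> lim_1_over_n)
  hence "L2_norm M (\<lambda>y. ?h (T y) - \<xi> * ?h y) \<le> 2 * 0 + 2 * norm f * 0"
    by (rule tendsto_lowerbound) (use le in auto)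
  hence "L2_norm M (\<lambda>y. ?h (T y) - \<xi> * ?h y) = 0" by (simp add: antisym)
  hence "AE y in M. ?h (T y) - \<xi> * ?h y = 0"
    by (subst (asm) L2_norm_eq_0_iff) (intro L2_diff L2_T L2_scale h)
  thus ?thesis by simp
qed

text \<open>
  On the orbit of \<open>x\<close> the averages for \<open>\<xi> = 1\<close> approach the constant \<open>c\<close>, which is \<open>\<integral>f\<close> because \<open>x\<close> is
  generic. This is the point where genericity for \<open>\<mu>\<close> turns into ergodicity of \<open>\<mu>\<close>.
\<close>

lemma eigencomponent_1: "AE y in M. eigencomponent f 1 y = (\<integral>z. f z \<partial>M)"
proof -
  let ?h = "eigencomponent f 1" and ?A = "FB_avg T f 1" and ?c = "\<integral>z. f z \<partial>M"
  have h: "?h \<in> L2 M" by (rule eigencomponent_L2) simp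
  have c: "FB_lim T f 1 x = ?c"
  proof (rule LIMSEQ_unique)
    show "(\<lambda>n. FB_avg T f 1 n x) \<longlonglongrightarrow> FB_lim T f 1 x" by (rule FB_avg_tendsto) simp
    show "(\<lambda>n. FB_avg T f 1 n x) \<longlonglongrightarrow> ?c"
      using generic_x unfolding generic_point_def FB_avg_def by simp
  qed
  have "L2_norm M (\<lambda>y. ?h y - ?c) \<le> 0"
  proof (rule field_le_epsilon)
    fix e :: real assume e: "0 < e"
    have "\<forall>\<^sub>F n in sequentially. asymp_rms_le (\<lambda>k. ?A n ((T ^^ k) x) - FB_lim T f 1 x * 1 ^ k) (e/2)"
      using e by (intro FB_avg_orbit) auto
    moreover have "\<forall>\<^sub>F n in sequentially. L2_norm M (\<lambda>y. ?A n y - ?h y) < e/2"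
      using e by (intro order_tendstoD(2)[OF eigencomponent_lim]) auto
    ultimately have "\<forall>\<^sub>F n in sequentially. L2_norm M (\<lambda>y. ?h y - ?c) \<le> e"
    proof eventually_elim
      case (elim n)
      have "L2_norm M (\<lambda>y. ?A n y - ?c) \<le> e/2"
        using elim(1) c by (intro generic_point_L2_le[OF generic_x] continuous_on_diff continuous_FB_avg) auto
      moreover have "L2_norm M (\<lambda>y. ?h y - ?c) \<le> L2_norm M (\<lambda>y. ?h y - ?A n y) + L2_norm M (\<lambda>y. ?A n y - ?c)"
        by (intro L2_triangle_diff h FB_avg_L2 L2_const)
      moreover have "L2_norm M (\<lambda>y. ?h y - ?A n y) = L2_norm M (\<lambda>y. ?A n y - ?h y)"
        by (rule L2_norm_minus_commute)
      ultimately show ?case using elim(2) by linarith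
    qed
    thus "L2_norm M (\<lambda>y. ?h y - ?c) \<le> 0 + e" by simp
  qed
  hence "L2_norm M (\<lambda>y. ?h y - ?c) = 0" by (simp add: antisym)
  hence "AE y in M. ?h y - ?c = 0"
    by (subst (asm) L2_norm_eq_0_iff) (intro L2_diff h L2_const)
  thus ?thesis by simp
qed

text \<open>
  On the orbit of \<open>x\<close>, \<open>f\<close> is close to the trigonometric polynomial with its own Fourier--Bohr
  coefficients, and the term of frequency \<open>\<xi>\<close> is close to \<open>A\<^sub>n[f, \<xi>\<^sup>-\<^sup>1]\<close> for large \<open>n\<close>. Transferring the
  estimate to \<open>L\<^sup>2\<close> replaces these averages by the eigencomponents.
\<close>

lemma bcontfun_near_eigencomponents:
  fixes f :: "'a \<Rightarrow>\<^sub>C complex"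
  assumes e: "0 < e"
  shows "\<exists>F. finite F \<and> F \<subseteq> S \<and> L2_norm M (\<lambda>y. f y - (\<Sum>\<xi>\<in>F. eigencomponent f \<xi> y)) < e"
proof -
  let ?A = "FB_avg T f" and ?h = "eigencomponent f" and ?c = "\<lambda>\<xi>. FB_lim T f \<xi> x"
  obtain F b where F: "finite F" "F \<subseteq> S"
    and b: "asymp_rms_le (\<lambda>k. f ((T ^^ k) x) - trig_poly F b k) (e/4)"
    using almost_periodicD[OF ap_x[of f], of "e/4"] e by auto
  have unit: "cmod \<xi> = 1" if "\<xi> \<in> F" for \<xi> using that F(2) S_unit by auto
  have "F \<subseteq> sphere 0 1" using F(2) S_unit by blast
  from trig_poly_best_approx[OF F(1) this generic_point_rms[OF generic_x] _ b]
  have c: "asymp_rms_le (\<lambda>k. f ((T ^^ k) x) - trig_poly F ?c k) (e/4)"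
    using FB_avg_tendsto[OF unit] by (simp add: FB_avg_eq_bohr_avg)
  \<comment> \<open>the admissible error for each single frequency, so that together they contribute at most \<open>e / 4\<close>\<close>
  define d where "d = e / (4 * (real (card F) + 1))"
  have d: "0 < d" "real (card F) * d \<le> e/4" using e by (auto simp: d_def field_simps)
  have "\<forall>\<^sub>F n in sequentially. \<forall>\<xi>\<in>F. asymp_rms_le (\<lambda>k. ?A \<xi> n ((T ^^ k) x) - ?c \<xi> * \<xi> ^ k) d"
    using d(1) by (intro eventually_ball_finite F(1) ballI FB_avg_orbit unit)
  moreover have "\<forall>\<^sub>F n in sequentially. \<forall>\<xi>\<in>F. L2_norm M (\<lambda>y. ?A \<xi> n y - ?h \<xi> y) < d"
    using d(1) by (intro eventually_ball_finite F(1) ballI order_tendstoD(2)[OF eigencomponent_lim] unit)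
  ultimately have "\<forall>\<^sub>F n in sequentially. L2_norm M (\<lambda>y. f y - (\<Sum>\<xi>\<in>F. ?h \<xi> y)) < e"
  proof eventually_elim
    case (elim n)
    have "asymp_rms_le (\<lambda>k. (f ((T ^^ k) x) - trig_poly F ?c k)
         - (\<Sum>\<xi>\<in>F. ?A \<xi> n ((T ^^ k) x) - ?c \<xi> * \<xi> ^ k)) (e/4 + (\<Sum>\<xi>\<in>F. d))"
      using elim(1) by (intro asymp_rms_le_diff asymp_rms_le_sum c F(1)) auto
    hence "asymp_rms_le (\<lambda>k. f ((T ^^ k) x) - (\<Sum>\<xi>\<in>F. ?A \<xi> n ((T ^^ k) x))) (e/4 + (\<Sum>\<xi>\<in>F. d))"
      by (simp add: trig_poly_def sum_subtractf)
    hence "L2_norm M (\<lambda>y. f y - (\<Sum>\<xi>\<in>F. ?A \<xi> n y)) \<le> e/4 + (\<Sum>\<xi>\<in>F. d)"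
      by (intro generic_point_L2_le[OF generic_x] continuous_on_diff continuous_on_sum continuous_FB_avg) auto
    moreover have "L2_norm M (\<lambda>y. (\<Sum>\<xi>\<in>F. ?A \<xi> n y) - (\<Sum>\<xi>\<in>F. ?h \<xi> y)) \<le> (\<Sum>\<xi>\<in>F. d)"
    proof -
      have "L2_norm M (\<lambda>y. \<Sum>\<xi>\<in>F. ?A \<xi> n y - ?h \<xi> y) \<le> (\<Sum>\<xi>\<in>F. L2_norm M (\<lambda>y. ?A \<xi> n y - ?h \<xi> y))"
        by (intro L2_norm_sum_le L2_diff FB_avg_L2 eigencomponent_L2 unit)
      also have "\<dots> \<le> (\<Sum>\<xi>\<in>F. d)" using elim(2) by (intro sum_mono) (auto intro: less_imp_le)
      finally show ?thesis by (simp add: sum_subtractf)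
    qed
    moreover have "L2_norm M (\<lambda>y. f y - (\<Sum>\<xi>\<in>F. ?h \<xi> y))
        \<le> L2_norm M (\<lambda>y. f y - (\<Sum>\<xi>\<in>F. ?A \<xi> n y)) + L2_norm M (\<lambda>y. (\<Sum>\<xi>\<in>F. ?A \<xi> n y) - (\<Sum>\<xi>\<in>F. ?h \<xi> y))"
      by (intro L2_triangle_diff L2_sum FB_avg_L2 eigencomponent_L2 unit bcontfun_L2)
    ultimately show ?case using d(2) e by simp
  qed
  hence "L2_norm M (\<lambda>y. f y - (\<Sum>\<xi>\<in>F. ?h \<xi> y)) < e" by simp
  with F show ?thesis by blast
qed

lemma L2_near_eigencomponents:
  assumes g: "g \<in> L2 M" and e: "0 < e"
  shows "\<exists>f F. finite F \<and> F \<subseteq> S \<and> L2_norm M (\<lambda>y. g y - (\<Sum>\<xi>\<in>F. eigencomponent f \<xi> y)) < e"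
proof -
  obtain f :: "'a \<Rightarrow>\<^sub>C complex" where f: "L2_norm M (\<lambda>y. g y - f y) < e/2"
    using continuous_dense_L2[OF g] e unfolding L2_approx_continuous_def by (meson half_gt_zero)
  obtain F where F: "finite F" "F \<subseteq> S" "L2_norm M (\<lambda>y. f y - (\<Sum>\<xi>\<in>F. eigencomponent f \<xi> y)) < e/2"
    using bcontfun_near_eigencomponents[of "e/2" f] e by auto
  have "(\<lambda>y. \<Sum>\<xi>\<in>F. eigencomponent f \<xi> y) \<in> L2 M"
    using F(2) S_unit by (intro L2_sum eigencomponent_L2) auto
  from L2_triangle_diff[OF g bcontfun_L2[of f] this] f F(3)
  have "L2_norm M (\<lambda>y. g y - (\<Sum>\<xi>\<in>F. eigencomponent f \<xi> y)) < e" by linarith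
  with F(1,2) show ?thesis by blast
qed

lemma orthogonal_eigencomponents_imp_zero:
  assumes g: "g \<in> L2 M" and orth: "\<And>f \<xi>. \<xi> \<in> S \<Longrightarrow> L2_inner M g (eigencomponent f \<xi>) = 0"
  shows "AE y in M. g y = 0"
proof -
  have "L2_norm M g \<le> 0"
  proof (rule field_le_epsilon)
    fix e :: real assume e: "0 < e"
    obtain f F where F: "finite F" "F \<subseteq> S"
      and lt: "L2_norm M (\<lambda>y. g y - (\<Sum>\<xi>\<in>F. eigencomponent f \<xi> y)) < e"
      using L2_near_eigencomponents[OF g e] by blast
    let ?s = "\<lambda>y. \<Sum>\<xi>\<in>F. eigencomponent f \<xi> y"
    have hL2: "eigencomponent f \<xi> \<in> L2 M" if "\<xi> \<in> F" for \<xi>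
      using that F(2) S_unit by (intro eigencomponent_L2) auto
    have s: "?s \<in> L2 M" by (intro L2_sum hL2)
    have "L2_inner M g ?s = (\<Sum>\<xi>\<in>F. L2_inner M g (eigencomponent f \<xi>))"
      by (intro L2_inner_sum_right g hL2)
    also have "\<dots> = 0" using F(2) by (intro sum.neutral ballI orth) auto
    finally have "L2_inner M g (\<lambda>y. g y - ?s y) = of_real ((L2_norm M g)\<^sup>2)"
      using L2_inner_diff_right[OF g g s] by (simp add: L2_inner_self)
    hence "cmod (L2_inner M g (\<lambda>y. g y - ?s y)) = (L2_norm M g)\<^sup>2"
      by (simp add: norm_power)
    hence "L2_norm M g * L2_norm M g \<le> L2_norm M g * L2_norm M (\<lambda>y. g y - ?s y)"
      using L2_cauchy_schwarz[OF g L2_diff[OF g s]] by (simp add: power2_eq_square)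
    hence "L2_norm M g \<le> L2_norm M (\<lambda>y. g y - ?s y)"
      by (cases "L2_norm M g = 0") (simp_all add: less_le)
    thus "L2_norm M g \<le> 0 + e" using lt by simp
  qed
  hence "L2_norm M g = 0" by (simp add: antisym)
  thus ?thesis using L2_norm_eq_0_iff[OF g] by simp
qed

text \<open>
  An eigenfunction with eigenvalue outside \<open>S\<close> would be orthogonal to every eigencomponent.
\<close>

proposition Spec_subset: "Spec T M \<subseteq> S"
proof
  fix \<eta> assume "\<eta> \<in> Spec T M"
  then obtain g where g: "g \<in> L2 M" "\<not> (AE y in M. g y = 0)" "AE y in M. g (T y) = \<eta> * g y"
    by (auto simp: Spec_def koopman_eigenfunction_def koopman_def)
  show "\<eta> \<in> S"
  proof (rule ccontr)
    assume \<eta>: "\<eta> \<notin> S"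
    have "AE y in M. g y = 0"
    proof (rule orthogonal_eigencomponents_imp_zero[OF g(1)])
      fix f \<xi> assume \<xi>: "\<xi> \<in> S"
      hence unit: "cmod \<xi> = 1" and neq: "\<xi> \<noteq> \<eta>" using S_unit \<eta> by auto
      show "L2_inner M g (eigencomponent f \<xi>) = 0"
        by (rule eigenfunctions_orthogonal[OF g(1,3) eigencomponent_L2[OF unit] eigencomponent_T[OF unit] unit neq])
    qed
    thus False using g(2) by blast
  qed
qed

text \<open>
  The centred indicator of an invariant set is \<open>T\<close>-invariant, so it is orthogonal to the eigencomponents for
  \<open>\<xi> \<noteq> 1\<close>; being of mean zero it is orthogonal to the constants, which are the eigencomponents for \<open>\<xi> = 1\<close>.
\<close>

proposition ergodic: "ergodic_measure T M"
  unfolding ergodic_measure_def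
proof (intro ballI impI)
  fix A assume A: "A \<in> sets M" "T -` A = A"
  define g where "g y = (indicator A y - of_real (prob A) :: complex)" for y
  have ind: "(indicator A :: 'a \<Rightarrow> complex) \<in> L2 M"
    by (rule L2_bounded[of _ 1]) (use A in \<open>auto simp: indicator_def\<close>)
  have g: "g \<in> L2 M" unfolding g_def by (intro L2_diff ind L2_const)
  have gT: "g (T y) = 1 * g y" for y
    using A(2) by (auto simp: g_def indicator_def)
  have int0: "(\<integral>y. g y \<partial>M) = 0"
  proof -
    have "(\<integral>y. g y \<partial>M) = (\<integral>y. indicator A y \<partial>M) - (\<integral>y. of_real (prob A) \<partial>M)"
      unfolding g_def by (intro Bochner_Integration.integral_diff L2_imp_integrable ind L2_const)
    also have "(\<integral>y. indicator A y \<partial>M) = (\<integral>y. complex_of_real (indicator A y) \<partial>M)"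
      by (intro Bochner_Integration.integral_cong) (auto simp: indicator_def)
    also have "\<dots> = complex_of_real (prob A)"
      using A(1) by (simp only: integral_complex_of_real) simp
    finally show ?thesis by (simp add: prob_UNIV)
  qed
  have "AE y in M. g y = 0"
  proof (rule orthogonal_eigencomponents_imp_zero[OF g])
    fix f \<xi> assume \<xi>: "\<xi> \<in> S"
    hence unit: "cmod \<xi> = 1" using S_unit by auto
    show "L2_inner M g (eigencomponent f \<xi>) = 0"
    proof (cases "\<xi> = 1")
      case False
      have "AE y in M. g (T y) = 1 * g y" by (intro AE_I2 gT)
      thus ?thesis
        by (rule eigenfunctions_orthogonal[OF g _ eigencomponent_L2[OF unit] eigencomponent_T[OF unit] unit False])
    next
      case True
      let ?c = "\<integral>z. f z \<partial>M"
      have "L2_inner M g (eigencomponent f 1) = (\<integral>y. g y * cnj ?c \<partial>M)"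
        unfolding L2_inner_def
      proof (rule integral_cong_AE)
        show "AE y in M. g y * cnj (eigencomponent f 1 y) = g y * cnj ?c"
          using eigencomponent_1[of f] by eventually_elim simp
      qed (intro borel_measurable_integrable L2_inner_integrable g eigencomponent_L2 L2_const; simp)+
      also have "\<dots> = 0" by (simp add: int0)
      finally show ?thesis using True by simp
    qed
  qed
  hence "AE y in M. indicator A y = complex_of_real (prob A)" by (simp add: g_def)
  hence "AE y in M. prob A = 0 \<or> prob A = 1"
  proof eventually_elim
    case (elim y)
    thus ?case by (cases "y \<in> A") (auto simp: complex_eq_iff)
  qed
  thus "prob A = 0 \<or> prob A = 1" by simp
qed

proposition discrete_spectrum: "discrete_spectrum T M"
  unfolding discrete_spectrum_def
proof (intro antisym subsetI)
  fix g assume "g \<in> kronecker_space T M"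
  thus "g \<in> L2 M" by (simp add: kronecker_space_def L2_closed_span_def)
next
  fix g assume g: "g \<in> L2 M"
  show "g \<in> kronecker_space T M"
    unfolding kronecker_space_def L2_closed_span_def mem_Collect_eq
  proof (intro conjI g allI impI)
    fix e :: real assume e: "0 < e"
    obtain f F where F: "finite F" "F \<subseteq> S"
      and lt: "L2_norm M (\<lambda>y. g y - (\<Sum>\<xi>\<in>F. eigencomponent f \<xi> y)) < e"
      using L2_near_eigencomponents[OF g e] by blast
    let ?h = "eigencomponent f"
    have unit: "cmod \<xi> = 1" if "\<xi> \<in> F" for \<xi> using that F(2) S_unit by auto
    \<comment> \<open>eigencomponents that vanish almost everywhere are not eigenfunctions and are dropped\<close>
    define G where "G = {\<xi>\<in>F. \<not> (AE y in M. ?h \<xi> y = 0)}"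
    have GF: "G \<subseteq> F" "finite G" using F(1) by (auto simp: G_def)
    \<comment> \<open>the closed span is built from sets of functions, so a multiplicity is recorded in case two
      frequencies have the same component\<close>
    define c where "c \<phi> = (of_nat (card {\<xi>\<in>G. ?h \<xi> = \<phi>}) :: complex)" for \<phi>
    have sum_G: "(\<Sum>\<phi>\<in>?h ` G. c \<phi> * \<phi> y) = (\<Sum>\<xi>\<in>G. ?h \<xi> y)" for y
    proof -
      have "(\<Sum>\<xi>\<in>G. ?h \<xi> y) = (\<Sum>\<phi>\<in>?h ` G. \<Sum>\<xi>\<in>{\<xi>\<in>G. ?h \<xi> = \<phi>}. ?h \<xi> y)"
        by (rule sum.image_gen[OF GF(2)])
      also have "\<dots> = (\<Sum>\<phi>\<in>?h ` G. c \<phi> * \<phi> y)"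
        by (intro sum.cong refl) (simp add: c_def)
      finally show ?thesis by simp
    qed
    have hL2: "?h \<xi> \<in> L2 M" if "\<xi> \<in> F" for \<xi> by (intro eigencomponent_L2 unit that)
    have "AE y in M. \<forall>\<xi>\<in>F - G. ?h \<xi> y = 0"
      using F(1) by (subst AE_finite_all) (auto simp: G_def)
    hence "AE y in M. g y - (\<Sum>\<xi>\<in>F. ?h \<xi> y) = g y - (\<Sum>\<phi>\<in>?h ` G. c \<phi> * \<phi> y)"
    proof eventually_elim
      case (elim y)
      have "(\<Sum>\<xi>\<in>F. ?h \<xi> y) = (\<Sum>\<xi>\<in>G. ?h \<xi> y)"
        using elim GF F(1) by (intro sum.mono_neutral_right) auto
      thus ?case by (simp add: sum_G)
    qed
    hence "L2_norm M (\<lambda>y. g y - (\<Sum>\<xi>\<in>F. ?h \<xi> y)) = L2_norm M (\<lambda>y. g y - (\<Sum>\<phi>\<in>?h ` G. c \<phi> * \<phi> y))"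
      using GF by (intro L2_norm_cong_AE L2_measurable L2_diff L2_sum L2_scale g) (auto intro!: hL2)
    moreover have "?h ` G \<subseteq> {\<phi>. \<exists>\<xi>. koopman_eigenfunction T M \<xi> \<phi>}"
    proof safe
      fix \<xi> assume "\<xi> \<in> G"
      hence "koopman_eigenfunction T M \<xi> (?h \<xi>)"
        using GF(1) hL2 eigencomponent_T[OF unit, of \<xi> f]
        by (auto simp: koopman_eigenfunction_def koopman_def G_def)
      thus "\<exists>\<eta>. koopman_eigenfunction T M \<eta> (?h \<xi>)" by blast
    qed
    ultimately show "\<exists>E c. finite E \<and> E \<subseteq> {\<phi>. \<exists>\<xi>. koopman_eigenfunction T M \<xi> \<phi>} \<and>
        L2_norm M (\<lambda>y. g y - (\<Sum>\<phi>\<in>E. c \<phi> * \<phi> y)) < e"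
      using lt GF(2) by (intro exI[of _ "?h ` G"] exI[of _ c]) simp
  qed
qed

section \<open>Wiener--Wintner genericity and the equivalence\<close>

lemma FB_exists_unit: "cmod \<xi> = 1 \<Longrightarrow> FB_exists T f \<xi> x"
  unfolding FB_exists_def using FB_avg_tendsto convergentI by blast

lemma FB_parseval:
  fixes f :: "'a \<Rightarrow>\<^sub>C complex"
  shows "ennreal (\<integral>y. (cmod (f y))\<^sup>2 \<partial>M) = FB_square_sum T f S x"
proof -
  have "ennreal ((L2_norm M f)\<^sup>2) = FB_square_sum T f S x"
    unfolding FB_square_sum_eq_SUP
    using parseval_mean[OF S_unit generic_point_rms[OF generic_x, of f], of "\<lambda>\<xi>. FB_lim T f \<xi> x"]
      ap_x[of f] FB_avg_tendsto[of _ f] S_unit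
    by (simp add: FB_avg_eq_bohr_avg subset_eq)
  thus ?thesis by (simp add: L2_norm_power2)
qed

lemma limsup_FB_avg:
  assumes "cmod \<xi> = 1"
  shows "limsup (\<lambda>n. ereal (cmod (FB_avg T f \<xi> n x))) = ereal (cmod (FB_lim T f \<xi> x))"
  by (intro lim_imp_Limsup tendsto_ereal tendsto_norm FB_avg_tendsto assms) simp

lemma Freq_eq: "Freq T x = {\<xi> \<in> sphere 0 1. \<exists>f. FB_lim T f \<xi> x \<noteq> 0}"
  unfolding Freq_def by (auto simp: limsup_FB_avg)

lemma Freq_subset: "Freq T x \<subseteq> S"
  using FB_lim_outside by (force simp: Freq_eq)

text \<open>
  Since the spectrum is discrete, the projection of \<open>f\<close> is \<open>f\<close> itself up to a null set, and Parseval's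
  equality over \<open>S\<close> is one over the frequencies of \<open>x\<close> because all other coefficients vanish.
\<close>

lemma WW_generic: "WW_generic_point T M x"
  unfolding WW_generic_point_def FB_generic_point_def
proof (intro conjI allI ballI generic_x)
  fix f :: "'a \<Rightarrow>\<^sub>C complex" and \<xi> :: complex assume "\<xi> \<in> sphere 0 1"
  thus "FB_exists T f \<xi> x" by (intro FB_exists_unit) simp
next
  fix f :: "'a \<Rightarrow>\<^sub>C complex"
  have K: "kronecker_space T M = L2 M" using discrete_spectrum by (simp add: discrete_spectrum_def)
  define p where "p = L2_proj M (kronecker_space T M) f"
  have "p \<in> L2 M \<and> (\<forall>h\<in>L2 M. L2_inner M (\<lambda>y. f y - p y) h = 0)"
    unfolding p_def L2_proj_def K
    by (rule someI[of _ "apply_bcontfun f"]) (simp add: L2_inner_def)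
  hence p: "p \<in> L2 M" and orth: "\<And>h. h \<in> L2 M \<Longrightarrow> L2_inner M (\<lambda>y. f y - p y) h = 0" by auto
  have d: "(\<lambda>y. f y - p y) \<in> L2 M" by (intro L2_diff bcontfun_L2 p)
  have "L2_norm M (\<lambda>y. f y - p y) = 0"
    using orth[OF d] by (simp add: L2_inner_self)
  hence "AE y in M. f y = p y" using L2_norm_eq_0_iff[OF d] by simp
  hence "L2_norm M p = L2_norm M f"
    using L2_norm_cong_AE[OF L2_measurable[OF bcontfun_L2[of f]] L2_measurable[OF p]] by simp
  hence "ennreal ((L2_norm M p)\<^sup>2) = FB_square_sum T f S x"
    using FB_parseval[of f] by (simp add: L2_norm_power2)
  also have "\<dots> = FB_square_sum T f (Freq T x) x"
    unfolding FB_square_sum_def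
  proof (rule infsum_cong_neutral)
    fix \<xi> assume "\<xi> \<in> S - Freq T x"
    thus "ennreal ((cmod (FB_lim T f \<xi> x))\<^sup>2) = 0" using S_unit by (auto simp: Freq_eq)
  qed (use Freq_subset in auto)
  finally show "ennreal ((L2_norm M (L2_proj M (kronecker_space T M) f))\<^sup>2) = FB_square_sum T f (Freq T x) x"
    unfolding p_def .
qed

end

text \<open>
  The converse of \<open>FB_parseval\<close>, with a dense set of functions in place of all of them.
\<close>

lemma (in compact_borel_system) almost_periodic_point_if_parseval:
  assumes S: "S \<subseteq> sphere 0 1" and x: "generic_point T M x"
    and D: "closure D = (UNIV :: ('a \<Rightarrow>\<^sub>C complex) set)"
    and ex: "\<And>f \<xi>. f \<in> D \<Longrightarrow> \<xi> \<in> S \<Longrightarrow> FB_exists T f \<xi> x"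
    and eq: "\<And>f. f \<in> D \<Longrightarrow> ennreal (\<integral>y. (cmod (f y))\<^sup>2 \<partial>M) = FB_square_sum T f S x"
  shows "almost_periodic_point S x"
  unfolding almost_periodic_point_def
proof (intro conjI allI x, rule almost_periodic_dense[OF D])
  fix f assume f: "f \<in> D"
  have lim: "(\<lambda>n. bohr_avg \<xi> n (\<lambda>k. f ((T ^^ k) x))) \<longlonglongrightarrow> FB_lim T f \<xi> x" if "\<xi> \<in> S" for \<xi>
    using ex[OF f that] unfolding FB_exists_def FB_lim_def convergent_LIMSEQ_iff FB_avg_eq_bohr_avg .
  have "ennreal ((L2_norm M f)\<^sup>2) = FB_square_sum T f S x"
    unfolding L2_norm_power2 by (rule eq[OF f])
  hence "ennreal ((L2_norm M f)\<^sup>2) =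
      (SUP F\<in>{F. finite F \<and> F \<subseteq> S}. \<Sum>\<xi>\<in>F. ennreal ((cmod (FB_lim T f \<xi> x))\<^sup>2))"
    unfolding FB_square_sum_eq_SUP .
  moreover have "(\<lambda>n. (rms n (\<lambda>k. f ((T ^^ k) x)))\<^sup>2) \<longlonglongrightarrow> (L2_norm M f)\<^sup>2"
    by (rule generic_point_rms[OF x continuous_on_apply_bcontfun])
  ultimately show "almost_periodic S (\<lambda>k. f ((T ^^ k) x))"
    using parseval_mean[where c = "\<lambda>\<xi>. FB_lim T f \<xi> x", OF S _ lim] by blast
qed

theorem theorem5p1:
  fixes T :: "'a::metric_space \<Rightarrow> 'a"
    and \<mu> :: "'a measure"
    and \<Xi> :: "complex set"
  assumes "compact (UNIV :: 'a set)"
    and "homeomorphism UNIV UNIV T (inv T)"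
    and "\<mu> \<in> invariant_prob_measures T"
    and "\<Xi> \<subseteq> sphere 0 1"
  shows
    "let C1 = (ergodic_measure T \<mu> \<and> discrete_spectrum T \<mu> \<and> Spec T \<mu> \<subseteq> \<Xi>);
         C2 = (\<exists>X'\<in>sets borel. measure \<mu> X' = 1 \<and>
                (\<forall>x\<in>X'. WW_generic_point T \<mu> x \<and>
                  (\<forall>f.
                     ennreal (\<integral>y. (cmod (apply_bcontfun f y))\<^sup>2 \<partial>\<mu>) = FB_square_sum T f \<Xi> x)));
         C3 = (\<exists>x. generic_point T \<mu> x \<and>
                (\<exists>D :: ('a \<Rightarrow>\<^sub>C complex) set. countable D \<and> closure D = UNIV \<and>
                  (\<forall>f\<in>D. (\<forall>\<xi>\<in>\<Xi>. FB_exists T f \<xi> x) \<and>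
                     ennreal (\<integral>y. (cmod (apply_bcontfun f y))\<^sup>2 \<partial>\<mu>) = FB_square_sum T f \<Xi> x)));
         C4 = (\<exists>x. WW_generic_point T \<mu> x \<and>
                (\<forall>f.
                   ennreal (\<integral>y. (cmod (apply_bcontfun f y))\<^sup>2 \<partial>\<mu>) = FB_square_sum T f \<Xi> x) \<and>
                Freq T x \<subseteq> \<Xi>)
     in (C1 \<longleftrightarrow> C2) \<and> (C2 \<longleftrightarrow> C3) \<and> (C3 \<longleftrightarrow> C4)"
proof -
  interpret prob_space \<mu>
    using assms(3) by (simp add: invariant_prob_measures_def)
  interpret compact_borel_system \<mu> T
  proof
    show "sets \<mu> = sets borel" "distr \<mu> borel T = \<mu>"
      using assms(3) by (simp_all add: invariant_prob_measures_def)
    show "continuous_on UNIV T" using assms(2) by (simp add: homeomorphism_def)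
    show "compact (UNIV :: 'a set)" by (rule assms(1))
  qed
  have system: "almost_periodic_system \<mu> T \<Xi> x" if "almost_periodic_point \<Xi> x" for x
    using that assms(4) by unfold_locales
  have ap_to_ergodic: "ergodic_measure T \<mu> \<and> discrete_spectrum T \<mu> \<and> Spec T \<mu> \<subseteq> \<Xi>"
    if "almost_periodic_point \<Xi> x" for x
    by (intro conjI almost_periodic_system.ergodic[OF system[OF that]]
        almost_periodic_system.discrete_spectrum[OF system[OF that]]
        almost_periodic_system.Spec_subset[OF system[OF that]])
  have ergodic_to_AE: "AE x in \<mu>. almost_periodic_point \<Xi> x"
    if "ergodic_measure T \<mu>" "discrete_spectrum T \<mu>" "Spec T \<mu> \<subseteq> \<Xi>"
  proof -
    interpret ergodic_compact_system \<mu> T by unfold_locales (rule that(1))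
    show ?thesis using that(2,3) by (rule AE_almost_periodic_point)
  qed
  have ap_of_dense: "almost_periodic_point \<Xi> x"
    if "generic_point T \<mu> x" "closure D = UNIV"
      "\<forall>f\<in>D. (\<forall>\<xi>\<in>\<Xi>. FB_exists T f \<xi> x) \<and>
         ennreal (\<integral>y. (cmod (apply_bcontfun f y))\<^sup>2 \<partial>\<mu>) = FB_square_sum T f \<Xi> x"
    for x and D :: "('a \<Rightarrow>\<^sub>C complex) set"
  proof (rule almost_periodic_point_if_parseval[OF assms(4) that(1,2)])
    fix f assume "f \<in> D"
    from bspec[OF that(3) this]
    show "ennreal (\<integral>y. (cmod (apply_bcontfun f y))\<^sup>2 \<partial>\<mu>) = FB_square_sum T f \<Xi> x" ..
  next
    fix f \<xi> assume "f \<in> D" "\<xi> \<in> \<Xi>"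
    thus "FB_exists T f \<xi> x" using that(3) by blast
  qed
  have ap_of_WW: "almost_periodic_point \<Xi> x"
    if WW: "WW_generic_point T \<mu> x"
      and eq: "\<forall>f. ennreal (\<integral>y. (cmod (apply_bcontfun f y))\<^sup>2 \<partial>\<mu>) = FB_square_sum T f \<Xi> x" for x
  proof (rule ap_of_dense[OF _ closure_UNIV])
    show "generic_point T \<mu> x"
      using WW by (simp add: WW_generic_point_def FB_generic_point_def)
    have "FB_exists T f \<xi> x" if "\<xi> \<in> \<Xi>" for f \<xi>
      using WW assms(4) that by (auto simp: WW_generic_point_def FB_generic_point_def)
    with eq show "\<forall>f\<in>UNIV. (\<forall>\<xi>\<in>\<Xi>. FB_exists T f \<xi> x) \<and>
         ennreal (\<integral>y. (cmod (apply_bcontfun f y))\<^sup>2 \<partial>\<mu>) = FB_square_sum T f \<Xi> x"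
      by simp
  qed
  note ap_WW = almost_periodic_system.WW_generic[OF system]
    and ap_parseval = almost_periodic_system.FB_parseval[OF system]
    and ap_Freq = almost_periodic_system.Freq_subset[OF system]

  have C1: "ergodic_measure T \<mu> \<and> discrete_spectrum T \<mu> \<and> Spec T \<mu> \<subseteq> \<Xi>
      \<longleftrightarrow> (\<exists>x. almost_periodic_point \<Xi> x)"
  proof
    assume "ergodic_measure T \<mu> \<and> discrete_spectrum T \<mu> \<and> Spec T \<mu> \<subseteq> \<Xi>"
    hence "AE x in \<mu>. almost_periodic_point \<Xi> x" by (intro ergodic_to_AE) auto
    hence "AE y in \<mu>. \<exists>x. almost_periodic_point \<Xi> x" by (rule eventually_mono) (rule exI)
    thus "\<exists>x. almost_periodic_point \<Xi> x" by simp
  qed (elim exE, rule ap_to_ergodic)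
  have C2: "(\<exists>X'\<in>sets borel. measure \<mu> X' = 1 \<and>
                (\<forall>x\<in>X'. WW_generic_point T \<mu> x \<and>
                  (\<forall>f.
                     ennreal (\<integral>y. (cmod (apply_bcontfun f y))\<^sup>2 \<partial>\<mu>) = FB_square_sum T f \<Xi> x)))
      \<longleftrightarrow> (\<exists>x. almost_periodic_point \<Xi> x)" (is "?C2 \<longleftrightarrow> _")
  proof
    assume ?C2
    then obtain X' where X': "measure \<mu> X' = 1" "\<forall>x\<in>X'. WW_generic_point T \<mu> x \<and>
        (\<forall>f. ennreal (\<integral>y. (cmod (apply_bcontfun f y))\<^sup>2 \<partial>\<mu>) = FB_square_sum T f \<Xi> x)"
      by blast
    from X'(1) have "X' \<noteq> {}" by auto
    then obtain x where "x \<in> X'" by blast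
    with X'(2) have "WW_generic_point T \<mu> x \<and>
        (\<forall>f. ennreal (\<integral>y. (cmod (apply_bcontfun f y))\<^sup>2 \<partial>\<mu>) = FB_square_sum T f \<Xi> x)"
      by (rule bspec)
    hence "almost_periodic_point \<Xi> x" using ap_of_WW by blast
    thus "\<exists>x. almost_periodic_point \<Xi> x" ..
  next
    assume "\<exists>x. almost_periodic_point \<Xi> x"
    from iffD2[OF C1 this] have "AE x in \<mu>. almost_periodic_point \<Xi> x"
      by (elim conjE, intro ergodic_to_AE)
    then obtain N where N: "N \<in> null_sets \<mu>" "{x \<in> space \<mu>. \<not> almost_periodic_point \<Xi> x} \<subseteq> N"
      unfolding eventually_ae_filter by blast
    show ?C2
    proof (rule bexI[of _ "UNIV - N"], intro conjI ballI)
      show "prob (UNIV - N) = 1"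
        using prob_compl[OF null_setsD2[OF N(1)]] measure_eq_0_null_sets[OF N(1)] by simp
      show "UNIV - N \<in> sets borel"
        using sets.compl_sets[OF null_setsD2[OF N(1)]] by (simp add: sets_borel)
      fix x assume "x \<in> UNIV - N"
      hence x: "almost_periodic_point \<Xi> x" using N(2) space_UNIV by blast
      show "WW_generic_point T \<mu> x" by (rule ap_WW[OF x])
      show "\<forall>f. ennreal (\<integral>y. (cmod (apply_bcontfun f y))\<^sup>2 \<partial>\<mu>) = FB_square_sum T f \<Xi> x"
        by (intro allI ap_parseval[OF x])
    qed
  qed
  have C3: "(\<exists>x. generic_point T \<mu> x \<and>
                (\<exists>D :: ('a \<Rightarrow>\<^sub>C complex) set. countable D \<and> closure D = UNIV \<and>
                  (\<forall>f\<in>D. (\<forall>\<xi>\<in>\<Xi>. FB_exists T f \<xi> x) \<and>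
                     ennreal (\<integral>y. (cmod (apply_bcontfun f y))\<^sup>2 \<partial>\<mu>) = FB_square_sum T f \<Xi> x)))
      \<longleftrightarrow> (\<exists>x. almost_periodic_point \<Xi> x)" (is "?C3 \<longleftrightarrow> _")
  proof
    assume ?C3
    then obtain x and D :: "('a \<Rightarrow>\<^sub>C complex) set" where "generic_point T \<mu> x" "closure D = UNIV"
      "\<forall>f\<in>D. (\<forall>\<xi>\<in>\<Xi>. FB_exists T f \<xi> x) \<and>
         ennreal (\<integral>y. (cmod (apply_bcontfun f y))\<^sup>2 \<partial>\<mu>) = FB_square_sum T f \<Xi> x"
      by blast
    hence "almost_periodic_point \<Xi> x" by (rule ap_of_dense)
    thus "\<exists>x. almost_periodic_point \<Xi> x" ..
  next
    assume "\<exists>x. almost_periodic_point \<Xi> x"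
    then obtain x where x: "almost_periodic_point \<Xi> x" ..
    obtain D :: "('a \<Rightarrow>\<^sub>C complex) set" where D: "countable D" "closure D = UNIV"
      using countable_dense_bcontfun[OF assms(1)] by blast
    have "cmod \<xi> = 1" if "\<xi> \<in> \<Xi>" for \<xi> using that assms(4) by auto
    hence "FB_exists T f \<xi> x" if "\<xi> \<in> \<Xi>" for f \<xi>
      using almost_periodic_system.FB_exists_unit[OF system[OF x]] that by simp
    with D show ?C3
      by (intro exI[of _ x] exI[of _ D] conjI ballI ap_parseval[OF x]
          almost_periodic_system.generic_x[OF system[OF x]])
  qed
  have C4: "(\<exists>x. WW_generic_point T \<mu> x \<and>
                (\<forall>f.
                   ennreal (\<integral>y. (cmod (apply_bcontfun f y))\<^sup>2 \<partial>\<mu>) = FB_square_sum T f \<Xi> x) \<and>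
                Freq T x \<subseteq> \<Xi>)
      \<longleftrightarrow> (\<exists>x. almost_periodic_point \<Xi> x)" (is "?C4 \<longleftrightarrow> _")
  proof
    assume ?C4
    then obtain x where "WW_generic_point T \<mu> x"
      "\<forall>f. ennreal (\<integral>y. (cmod (apply_bcontfun f y))\<^sup>2 \<partial>\<mu>) = FB_square_sum T f \<Xi> x"
      by blast
    hence "almost_periodic_point \<Xi> x" by (rule ap_of_WW)
    thus "\<exists>x. almost_periodic_point \<Xi> x" ..
  next
    assume "\<exists>x. almost_periodic_point \<Xi> x"
    then obtain x where x: "almost_periodic_point \<Xi> x" ..
    show ?C4
      by (intro exI[of _ x] conjI allI ap_WW[OF x] ap_parseval[OF x] ap_Freq[OF x])
  qed
  show ?thesis by (simp only: Let_def C1 C2 C3 C4 simp_thms)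
qed

end
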